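(* Let $\mathcal H=\mathcal H_n$ be uniformly sparse and let $\mathcal P=\mathcal P_n,\mathcal Q=\mathcal Q_n$ be Rényi-stable. In the hidden weighted graph model the following hold (as $n\to\infty$). 1. If $D_{\mathrm{KL}}(\mathcal P\|\mathcal Q)\ge(1+\eta)\log(p_{1M}^{-1})$ for some constant $\eta>0$, then the maximum likelihood estimator achieves almost exact recovery. 2. Conversely, if some estimator achieves almost exact recovery, then $D_{\mathrm{KL}}(\mathcal P\|\mathcal Q)\ge(1-o(1))\log(p_{1M}^{-1})$. 3. If $D_{\mathrm{KL}}(\mathcal P\|\mathcal Q)\le(\lambda-\eta)\log(p_{1M}^{-1})$ for some constants $0<\eta<\lambda<1$, then every estimator $\hat H$ (computationally efficient or not) fails to recover a $\lambda$-fraction of the hidden edges with high probability, i.e. $\Pr[|\hat H\cap H^*|\ge\lambda m]\to0$. 4. If $D_2(\mathcal P\|\mathcal Q)\le(1-\eta)\log(p_{1M}^{-1})$ for some constant $\eta>0$, then every estimator $\hat H$ (computationally efficient or not) fails to recover any constant fraction of the hidden edges with high probability, i.e. for every constant $\lambda\in(0,1)$, $\Pr[|\hat H\cap H^*|\ge\lambda m]\to0$.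
   Context: Hidden weighted graph model. For each positive integer $n$, let $K_n$ be the complete graph on $n$ labelled vertices and $N=\binom n2$ its number of edges. $\mathcal H=\mathcal H_n$ is a nonempty collection of subgraphs of $K_n$ (identified with their edge sets), each having exactly $m=m_n$ edges, where $m\to\infty$ as $n\to\infty$. $\mathcal P=\mathcal P_n$ and $\mathcal Q=\mathcal Q_n$ are probability distributions (of edge weights) with $\mathcal P\ll\mathcal Q$. A graph $H^*$ is drawn uniformly at random from $\mathcal H$; conditionally on $H^*$, the weights $A_e$ of the edges $e$ of $K_n$ are independent, with $A_e\sim\mathcal P$ if $e\in H^*$ and $A_e\sim\mathcal Q$ otherwise. An estimator $\hat H$ is a (possibly randomized) function of $A=(A_e)_e$ (it may depend on $\mathcal P,\mathcal Q,\mathcal H$) with values in $\mathcal H$. The maximum likelihood estimator (MLE) outputs a maximizer over $H\in\mathcal H$ of $\sum_{e\in H}\log\frac{d\mathcal P}{d\mathcal Q}(A_e)$. Almost exact recovery: $\hat H$ achieves it if there is a sequence $\delta_n\to0$ with $\Pr[|\hat H\cap H^*|<(1-\delta_n)m]\to0$. $M=|\mathcal H|$ and $p_{1M}=p_{1M}(\mathcal H)=M^{-1/m}$, so $\log M=m\log(p_{1M}^{-1})$; $\log$ is natural, $\log 0=-\infty$. Uniformly sparse: $\log(p_{1M}^{-1})=\omega(1)$ and $$\max_{H_1\in\mathcal H}\ \max_{\ell\in\{0,1,\dots,m\}}\Big\{\log\Pr_{H_2\sim\mathcal H}[|H_1\cap H_2|=\ell]+\ell\log(p_{1M}^{-1})\Big\}=o(\log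 M),$$ where $H_2\sim\mathcal H$ is uniform on $\mathcal H$. Rényi divergence: $D_\alpha(\mathcal P\|\mathcal Q)=\frac1{\alpha-1}\log\mathbb E_{\mathcal P}\big[(\frac{d\mathcal P}{d\mathcal Q})^{\alpha-1}\big]$ for $\alpha\in(0,1)\cup(1,\infty)$, and $D_1=D_{\mathrm{KL}}$. Rényi-stable: both of the following hold. (Upper) For any fixed $\theta>0$ there exists $\alpha_n\in(0,1)$ with $\alpha_n\to1$ and $1-\alpha_n=\omega(1/D_{\mathrm{KL}}(\mathcal P\|\mathcal Q))$ such that $D_{\alpha_n}(\mathcal P\|\mathcal Q)\ge(1-\theta)D_{\mathrm{KL}}(\mathcal P\|\mathcal Q)$ for all sufficiently large $n$. (Lower) For any fixed $\theta>0$ there exists $\beta_n>1$ with $\beta_n\to1$ and $\beta_n-1=\Omega(1/D_{\mathrm{KL}}(\mathcal P\|\mathcal Q))$ such that $D_{\beta_n}(\mathcal P\|\mathcal Q)\le(1+\theta)D_{\mathrm{KL}}(\mathcal P\|\mathcal Q)$ for all sufficiently large $n$. *)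

theory Defs
  imports "HOL-Probability.Probability" "HOL-Library.Landau_Symbols" "HOL-Library.Ramsey"
begin

text \<open>A subgraph of the complete graph on the vertices \<open>0, \<dots>, n - 1\<close> is identified with its
  edge set, an edge being a two-element set of vertices.\<close>

type_synonym graph = "nat set set"

definition complete_edges :: "nat \<Rightarrow> graph" where
  "complete_edges n = nsets {..<n} 2"

text \<open>The natural logarithm with \<open>log 0 = -\<infinity>\<close>; recall that \<^term>\<open>ln (0::real) = 0\<close>.\<close>

definition eln :: "ennreal \<Rightarrow> ereal" where
  "eln x = (if x = 0 then - \<infinity> else if x = top then \<infinity> else ereal (ln (enn2real x)))"

text \<open>For probability measures with \<open>P\<close> absolutely continuous with respect to \<open>Q\<close>, the negative
  part of \<open>log (dP/dQ)\<close> is always \<open>P\<close>-integrable, so the divergence is \<open>\<infinity>\<close> whenever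
  \<open>log (dP/dQ)\<close> is not integrable (where \<^const>\<open>KL_divergence\<close> would return \<open>0\<close>).
  The arguments of \<^const>\<open>KL_divergence\<close>, like those of \<^const>\<open>RN_deriv\<close>, are swapped
  with respect to the usual notation.\<close>

definition kl_div :: "'w measure \<Rightarrow> 'w measure \<Rightarrow> ereal" where
  "kl_div P Q =
     (if integrable P (entropy_density (exp 1) Q P) then ereal (KL_divergence (exp 1) Q P) else \<infinity>)"

text \<open>The points where \<open>dP/dQ\<close> is \<open>0\<close> or \<open>\<infinity>\<close> form a \<open>P\<close>-null set.\<close>

definition renyi_div :: "real \<Rightarrow> 'w measure \<Rightarrow> 'w measure \<Rightarrow> ereal" where
  "renyi_div \<alpha> P Q =
     (if \<alpha> = 1 then kl_div P Q
      else ereal (1 / (\<alpha> - 1)) *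
           eln (\<integral>\<^sup>+ x. ennreal (enn2real (RN_deriv Q P x) powr (\<alpha> - 1)) \<partial>P))"

text \<open>The conditions \<open>1 - \<alpha>\<^sub>n = \<omega>(1 / D)\<close> and \<open>\<beta>\<^sub>n - 1 = \<Omega>(1 / D)\<close> are multiplied out, because
  the divergence \<open>D\<close> is extended-real valued and may vanish.\<close>

definition renyi_stable_upper :: "(nat \<Rightarrow> 'w measure) \<Rightarrow> (nat \<Rightarrow> 'w measure) \<Rightarrow> bool" where
  "renyi_stable_upper P Q \<longleftrightarrow>
     (\<forall>\<theta>>0. \<exists>\<alpha> :: nat \<Rightarrow> real.
        (\<forall>n. 0 < \<alpha> n \<and> \<alpha> n < 1) \<and> \<alpha> \<longlonglongrightarrow> 1 \<and>
        (\<lambda>n. ereal (1 - \<alpha> n) * kl_div (P n) (Q n)) \<longlonglongrightarrow> \<infinity> \<and>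
        (\<forall>\<^sub>F n in sequentially.
           renyi_div (\<alpha> n) (P n) (Q n) \<ge> ereal (1 - \<theta>) * kl_div (P n) (Q n)))"

definition renyi_stable_lower :: "(nat \<Rightarrow> 'w measure) \<Rightarrow> (nat \<Rightarrow> 'w measure) \<Rightarrow> bool" where
  "renyi_stable_lower P Q \<longleftrightarrow>
     (\<forall>\<theta>>0. \<exists>\<beta> :: nat \<Rightarrow> real.
        (\<forall>n. 1 < \<beta> n) \<and> \<beta> \<longlonglongrightarrow> 1 \<and>
        (\<exists>c>0. \<forall>\<^sub>F n in sequentially. ereal (\<beta> n - 1) * kl_div (P n) (Q n) \<ge> ereal c) \<and>
        (\<forall>\<^sub>F n in sequentially.
           renyi_div (\<beta> n) (P n) (Q n) \<le> ereal (1 + \<theta>) * kl_div (P n) (Q n)))"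

definition renyi_stable :: "(nat \<Rightarrow> 'w measure) \<Rightarrow> (nat \<Rightarrow> 'w measure) \<Rightarrow> bool" where
  "renyi_stable P Q \<longleftrightarrow> renyi_stable_upper P Q \<and> renyi_stable_lower P Q"

text \<open>In \<open>absolutely_continuous M N\<close> it is \<open>N\<close> that is absolutely continuous with respect
  to \<open>M\<close>.\<close>

locale hidden_weighted_graph =
  fixes H :: "nat \<Rightarrow> graph set" and m :: "nat \<Rightarrow> nat" and P Q :: "nat \<Rightarrow> 'w measure"
  assumes H_nonempty: "n \<ge> 1 \<Longrightarrow> H n \<noteq> {}"
    and H_subgraph: "n \<ge> 1 \<Longrightarrow> S \<in> H n \<Longrightarrow> S \<subseteq> complete_edges n"
    and H_card: "n \<ge> 1 \<Longrightarrow> S \<in> H n \<Longrightarrow> card S = m n"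
    and m_at_top: "filterlim m at_top sequentially"
    and prob_space_P: "n \<ge> 1 \<Longrightarrow> prob_space (P n)"
    and prob_space_Q: "n \<ge> 1 \<Longrightarrow> prob_space (Q n)"
    and sets_P: "n \<ge> 1 \<Longrightarrow> sets (P n) = sets (Q n)"
    and P_ac_Q: "n \<ge> 1 \<Longrightarrow> absolutely_continuous (Q n) (P n)"

definition p1M :: "graph set \<Rightarrow> nat \<Rightarrow> real" where
  "p1M H m = real (card H) powr (- 1 / real m)"

text \<open>The maximum below is a nonnegative real number, as the term for \<open>l = m\<close> equals
  \<open>- log M + m * log (1 / p1M) = 0\<close>; hence \<^const>\<open>real_of_ereal\<close> loses nothing.\<close>

definition uniformly_sparse :: "(nat \<Rightarrow> graph set) \<Rightarrow> (nat \<Rightarrow> nat) \<Rightarrow> bool" where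
  "uniformly_sparse H m \<longleftrightarrow>
     (\<lambda>n. ln (1 / p1M (H n) (m n))) \<in> \<omega>(\<lambda>_. 1) \<and>
     (\<lambda>n. real_of_ereal
        (MAX H1\<in>H n. MAX l\<in>{0..m n}.
           eln (ennreal (measure_pmf.prob (pmf_of_set (H n)) {H2. card (H1 \<inter> H2) = l}))
           + ereal (real l * ln (1 / p1M (H n) (m n)))))
       \<in> o(\<lambda>n. ln (real (card (H n))))"

definition weights_law :: "nat \<Rightarrow> 'w measure \<Rightarrow> 'w measure \<Rightarrow> graph \<Rightarrow> (nat set \<Rightarrow> 'w) measure" where
  "weights_law n P Q S = PiM (complete_edges n) (\<lambda>e. if e \<in> S then P else Q)"

text \<open>A randomized function of the weights with values in \<open>H n\<close> is a probability kernel: given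
  the weights \<open>A\<close>, the estimate has law \<open>K n A\<close>. Deterministic estimators correspond to Dirac
  kernels.\<close>

definition estimator ::
    "(nat \<Rightarrow> graph set) \<Rightarrow> (nat \<Rightarrow> 'w measure) \<Rightarrow> (nat \<Rightarrow> (nat set \<Rightarrow> 'w) \<Rightarrow> graph measure) \<Rightarrow> bool" where
  "estimator H Q K \<longleftrightarrow>
     (\<forall>n\<ge>1. K n \<in> PiM (complete_edges n) (\<lambda>_. Q n) \<rightarrow>\<^sub>M prob_algebra (count_space (H n)))"

text \<open>The hidden graph is the first component, the estimate the second one.\<close>

definition recovery_law ::
    "nat \<Rightarrow> graph set \<Rightarrow> 'w measure \<Rightarrow> 'w measure \<Rightarrow> ((nat set \<Rightarrow> 'w) \<Rightarrow> graph measure) \<Rightarrow>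
     (graph \<times> graph) measure" where
  "recovery_law n H P Q K =
     measure_pmf (pmf_of_set H) \<bind> (\<lambda>S.
       weights_law n P Q S \<bind> (\<lambda>A.
         K A \<bind> (\<lambda>G. return (count_space UNIV) (S, G))))"

definition log_likelihood_ratio ::
    "'w measure \<Rightarrow> 'w measure \<Rightarrow> (nat set \<Rightarrow> 'w) \<Rightarrow> graph \<Rightarrow> ereal" where
  "log_likelihood_ratio P Q A S = (\<Sum>e\<in>S. eln (RN_deriv Q P (A e)))"

text \<open>Ties between maximizers may be broken in any way, possibly at random.\<close>

definition maximum_likelihood_estimator ::
    "(nat \<Rightarrow> graph set) \<Rightarrow> (nat \<Rightarrow> 'w measure) \<Rightarrow> (nat \<Rightarrow> 'w measure) \<Rightarrow>
     (nat \<Rightarrow> (nat set \<Rightarrow> 'w) \<Rightarrow> graph measure) \<Rightarrow> bool" where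
  "maximum_likelihood_estimator H P Q K \<longleftrightarrow>
     estimator H Q K \<and>
     (\<forall>n\<ge>1. \<forall>A\<in>space (PiM (complete_edges n) (\<lambda>_. Q n)).
        AE G in K n A. is_arg_max (log_likelihood_ratio (P n) (Q n) A) (\<lambda>S. S \<in> H n) G)"

definition almost_exact_recovery ::
    "(nat \<Rightarrow> graph set) \<Rightarrow> (nat \<Rightarrow> nat) \<Rightarrow> (nat \<Rightarrow> 'w measure) \<Rightarrow> (nat \<Rightarrow> 'w measure) \<Rightarrow>
     (nat \<Rightarrow> (nat set \<Rightarrow> 'w) \<Rightarrow> graph measure) \<Rightarrow> bool" where
  "almost_exact_recovery H m P Q K \<longleftrightarrow>
     (\<exists>\<delta> :: nat \<Rightarrow> real. \<delta> \<longlonglongrightarrow> 0 \<and>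
        (\<lambda>n. measure (recovery_law n (H n) (P n) (Q n) (K n))
               {(S, G). real (card (G \<inter> S)) < (1 - \<delta> n) * real (m n)}) \<longlonglongrightarrow> 0)"

definition fails_to_recover_fraction ::
    "(nat \<Rightarrow> graph set) \<Rightarrow> (nat \<Rightarrow> nat) \<Rightarrow> (nat \<Rightarrow> 'w measure) \<Rightarrow> (nat \<Rightarrow> 'w measure) \<Rightarrow>
     (nat \<Rightarrow> (nat set \<Rightarrow> 'w) \<Rightarrow> graph measure) \<Rightarrow> real \<Rightarrow> bool" where
  "fails_to_recover_fraction H m P Q K lam \<longleftrightarrow>
     (\<lambda>n. measure (recovery_law n (H n) (P n) (Q n) (K n))
            {(S, G). real (card (G \<inter> S)) \<ge> lam * real (m n)}) \<longlonglongrightarrow> 0"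

end

theory Submission
  imports Defs
begin

text \<open>Write \<open>L = log (1 / p\<^bsub>1M\<^esub>)\<close>, so that \<open>M = exp (m L)\<close>. Uniform sparsity says that at most a fraction
  \<open>exp (- l L + o(m L))\<close> of the graphs in \<open>\<H>\<close> share \<open>l\<close> edges with a given one.

  Achievability: if the maximum likelihood estimate \<open>G\<close> differs from \<open>S = H\<^sup>*\<close> in \<open>k\<close> edges, then the
  likelihood ratio over \<open>S - G\<close> is at most that over \<open>G - S\<close>. The former exceeds \<open>exp (k z)\<close> with
  \<open>z\<close> slightly below \<open>D\<^bsub>KL\<^esub>\<close> for all of the at most \<open>2 ^ m\<close> sets \<open>S - G\<close>, by a Chernoff bound
  with \<open>\<alpha> < 1\<close>; the latter has mean one, so Markov's inequality and a union bound over the graphs at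
  distance \<open>k\<close> suffice once \<open>z > L\<close>.

  Impossibility: the planted law has density \<open>\<Prod>e\<in>S. dP/dQ (A e)\<close> with respect to the law without
  planted edges, under which the estimate is independent of \<open>S\<close>. A Chernoff bound with \<open>\<beta> > 1\<close> shows
  that this density is below \<open>exp (m (\<lambda> - \<eta> / 2) L)\<close> with high probability, while under the null law an
  overlap of \<open>\<lambda> m\<close> has probability about \<open>exp (- \<lambda> m L)\<close>.

  All or nothing: graphs meeting the estimate in \<open>\<lambda> m\<close> edges must overlap pairwise, on average, in
  \<open>\<lambda>\<^sup>2 m\<close> edges, so the square of their total density is controlled by the pairs with overlap at least
  \<open>\<lambda>\<^sup>2 m / 2\<close>. The null expectation of that pair sum is small when \<open>D\<^sub>2 \<le> (1 - \<eta>) L\<close>.\<close>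

section \<open>Extended logarithms and divergences\<close>

lemma eln_le_iff: "eln x \<le> ereal y \<longleftrightarrow> x \<le> ennreal (exp y)"
proof (cases x)
  case (real r)
  show ?thesis
  proof (cases "r = 0")
    case False
    with real have "r > 0" by simp
    then have "eln x \<le> ereal y \<longleftrightarrow> ln r \<le> y"
      using real by (simp add: eln_def)
    also have "\<dots> \<longleftrightarrow> r \<le> exp y" using \<open>r > 0\<close> by (metis exp_le_cancel_iff exp_ln)
    finally show ?thesis using real by simp
  qed (use real in \<open>simp add: eln_def\<close>)
qed (auto simp: eln_def top_unique)

lemma eln_le_eln_iff: "eln x \<le> eln y \<longleftrightarrow> x \<le> y"
proof (cases y)
  case (real r)
  show ?thesis
  proof (cases "r = 0")
    case False
    with real have "r > 0" by simp
    then have "eln y = ereal (ln r)" using real by (simp add: eln_def)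
    then show ?thesis using real \<open>r > 0\<close> by (simp add: eln_le_iff)
  qed (use real in \<open>auto simp: eln_def\<close>)
qed (auto simp: eln_def top_unique)

text \<open>The only failure is \<open>0 * \<infinity> = 0\<close>: its logarithm is
  \<open>- \<infinity>\<close>, whereas \<open>- \<infinity> + \<infinity> = \<infinity>\<close> in
  \<open>ereal\<close>.\<close>

lemma eln_mult: "x \<noteq> \<infinity> \<Longrightarrow> y \<noteq> \<infinity> \<Longrightarrow> eln (x * y) = eln x + eln y"
  by (cases x; cases y) (auto simp: eln_def ln_mult ennreal_mult[symmetric] ennreal_mult_eq_top_iff enn2real_mult)

lemma eln_prod:
  "(\<And>i. i \<in> I \<Longrightarrow> f i \<noteq> \<infinity>) \<Longrightarrow> eln (\<Prod>i\<in>I. f i) = (\<Sum>i\<in>I. eln (f i))"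
proof (induction I rule: infinite_finite_induct)
  case (insert i I)
  then show ?case by (auto simp: eln_mult ennreal_prod_eq_top)
qed (auto simp: eln_def)

text \<open>The factor \<open>1 / (\<alpha> - 1)\<close> is negative here, so a lower bound on the
  divergence is an upper bound on a negative moment of the likelihood ratio, which is what a
  Chernoff bound on its lower tail needs.\<close>

lemma renyi_div_ge_imp:
  assumes "\<alpha> < 1" "ereal z \<le> renyi_div \<alpha> P Q"
  shows "(\<integral>\<^sup>+ x. ennreal (enn2real (RN_deriv Q P x) powr (\<alpha> - 1)) \<partial>P) \<le> ennreal (exp ((\<alpha> - 1) * z))"
proof -
  define y where "y = eln (\<integral>\<^sup>+ x. ennreal (enn2real (RN_deriv Q P x) powr (\<alpha> - 1)) \<partial>P)"
  have "ereal z \<le> ereal (1 / (\<alpha> - 1)) * y"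
    using assms by (simp add: renyi_div_def y_def)
  then have "y \<le> ereal ((\<alpha> - 1) * z)"
    using assms(1) by (cases y) (auto simp: field_simps split: if_splits)
  then show ?thesis by (simp add: y_def eln_le_iff)
qed

lemma renyi_div_le_imp:
  assumes "\<alpha> > 1" "renyi_div \<alpha> P Q \<le> ereal z"
  shows "(\<integral>\<^sup>+ x. ennreal (enn2real (RN_deriv Q P x) powr (\<alpha> - 1)) \<partial>P) \<le> ennreal (exp ((\<alpha> - 1) * z))"
proof -
  define y where "y = eln (\<integral>\<^sup>+ x. ennreal (enn2real (RN_deriv Q P x) powr (\<alpha> - 1)) \<partial>P)"
  have "ereal (1 / (\<alpha> - 1)) * y \<le> ereal z"
    using assms by (simp add: renyi_div_def y_def)
  then have "y \<le> ereal ((\<alpha> - 1) * z)"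
    using assms(1) by (cases y) (auto simp: field_simps split: if_splits)
  then show ?thesis by (simp add: y_def eln_le_iff)
qed

lemma kl_div_cases: obtains d where "kl_div P Q = ereal d" | "kl_div P Q = \<infinity>"
  by (cases "integrable P (entropy_density (exp 1) Q P)") (simp_all add: kl_div_def)

section \<open>Overlapping set families\<close>

text \<open>Grouping by overlap leaves \<open>m + 1\<close> levels, each worth at most
  \<open>C\<close>. In the applications \<open>g\<close> is the sparsity bound, and \<open>f\<close>
  is an exponential tail bound, the constant 1, or a second moment \<open>B ^ l\<close>.\<close>

lemma sum_overlap_le:
  fixes H :: "'a set set" and S :: "'a set" and f :: "nat \<Rightarrow> real"
  assumes fin: "finite H" and le: "\<And>S'. S' \<in> H \<Longrightarrow> card (S \<inter> S') \<le> m"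
    and sparse: "\<And>l. l \<le> m \<Longrightarrow> real (card {S'\<in>H. card (S \<inter> S') = l}) \<le> g l"
    and f: "\<And>l. 0 \<le> f l" and C: "\<And>l. l \<le> m \<Longrightarrow> p l \<Longrightarrow> g l * f l \<le> C" and "0 \<le> C"
  shows "(\<Sum>S' | S' \<in> H \<and> p (card (S \<inter> S')). f (card (S \<inter> S'))) \<le> (real m + 1) * C"
proof -
  have "(\<Sum>S' | S' \<in> H \<and> p (card (S \<inter> S')). f (card (S \<inter> S'))) =
      (\<Sum>l\<in>{..m}. \<Sum>S' | S' \<in> {S' \<in> H. p (card (S \<inter> S'))} \<and> card (S \<inter> S') = l. f (card (S \<inter> S')))"
    using fin le by (intro sum.group[symmetric]) auto
  also have "\<dots> \<le> (\<Sum>l\<in>{..m}. C)"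
  proof (rule sum_mono)
    fix l assume "l \<in> {..m}"
    then have l: "l \<le> m" by simp
    show "(\<Sum>S' | S' \<in> {S' \<in> H. p (card (S \<inter> S'))} \<and> card (S \<inter> S') = l. f (card (S \<inter> S'))) \<le> C"
    proof (cases "p l")
      case True
      have "(\<Sum>S' | S' \<in> {S' \<in> H. p (card (S \<inter> S'))} \<and> card (S \<inter> S') = l. f (card (S \<inter> S'))) =
          (\<Sum>S' | S' \<in> H \<and> card (S \<inter> S') = l. f l)"
        using True by (intro sum.cong) auto
      also have "\<dots> = real (card {S'\<in>H. card (S \<inter> S') = l}) * f l" by simp
      also have "\<dots> \<le> g l * f l" using sparse[OF l] f by (rule mult_right_mono)
      also have "\<dots> \<le> C" using C l True by blast
      finally show ?thesis .
    next
      case False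
      then have "{S'. S' \<in> {S' \<in> H. p (card (S \<inter> S'))} \<and> card (S \<inter> S') = l} = {}" by auto
      with \<open>0 \<le> C\<close> show ?thesis by (simp only: sum.empty)
    qed
  qed
  also have "\<dots> = (real m + 1) * C" by simp
  finally show ?thesis .
qed

text \<open>By Cauchy--Schwarz over the points of \<open>G\<close>.\<close>

lemma overlapping_family_pair_sum:
  fixes w :: "'a set \<Rightarrow> real"
  assumes "finite F" "finite G" and w: "\<And>S. S \<in> F \<Longrightarrow> 0 \<le> w S"
    and fin: "\<And>S. S \<in> F \<Longrightarrow> finite S" and "0 \<le> a"
    and meet: "\<And>S. S \<in> F \<Longrightarrow> a \<le> real (card (G \<inter> S))"
  shows "(a * (\<Sum>S\<in>F. w S))\<^sup>2 \<le> real (card G) * (\<Sum>S\<in>F. \<Sum>S'\<in>F. w S * w S' * real (card (S \<inter> S')))"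
proof -
  have card_eq: "real (card (G \<inter> T)) = (\<Sum>e\<in>G. of_bool (e \<in> T))" for T
    using \<open>finite G\<close> by (simp add: sum.If_cases of_bool_def Int_def)
  define f where "f e = (\<Sum>S\<in>F. w S * of_bool (e \<in> S))" for e
  have "a * (\<Sum>S\<in>F. w S) \<le> (\<Sum>S\<in>F. w S * real (card (G \<inter> S)))"
    unfolding sum_distrib_left
    by (intro sum_mono) (metis meet w mult.commute mult_left_mono)
  also have "\<dots> = (\<Sum>e\<in>G. f e)"
    unfolding f_def card_eq sum_distrib_left by (rule sum.swap)
  finally have "(a * (\<Sum>S\<in>F. w S))\<^sup>2 \<le> (\<Sum>e\<in>G. f e)\<^sup>2"
    using w \<open>0 \<le> a\<close> by (intro power_mono) (auto intro!: mult_nonneg_nonneg sum_nonneg)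
  also have "(\<Sum>e\<in>G. f e)\<^sup>2 \<le> real (card G) * (\<Sum>e\<in>G. (f e)\<^sup>2)"
    using sum_squared_le_sum_of_squares[of f G] by (simp add: mult.commute)
  also have "(\<Sum>e\<in>G. (f e)\<^sup>2) = (\<Sum>e\<in>G. \<Sum>S\<in>F. \<Sum>S'\<in>F. w S * w S' * of_bool (e \<in> S \<inter> S'))"
    unfolding f_def power2_eq_square sum_product
    by (intro sum.cong refl) (simp add: of_bool_conj ac_simps)
  also have "\<dots> = (\<Sum>S\<in>F. \<Sum>S'\<in>F. \<Sum>e\<in>G. w S * w S' * of_bool (e \<in> S \<inter> S'))"
    by (subst sum.swap, rule sum.cong[OF refl], rule sum.swap)
  also have "\<dots> = (\<Sum>S\<in>F. \<Sum>S'\<in>F. w S * w S' * real (card (G \<inter> (S \<inter> S'))))"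
    by (simp only: card_eq sum_distrib_left)
  also have "\<dots> \<le> (\<Sum>S\<in>F. \<Sum>S'\<in>F. w S * w S' * real (card (S \<inter> S')))"
    using w fin by (intro sum_mono mult_left_mono of_nat_mono card_mono mult_nonneg_nonneg) auto
  finally show ?thesis by (simp add: mult_left_mono)
qed

text \<open>In the pair sum of \<open>overlapping_family_pair_sum\<close>, pairs with overlap below
  \<open>b = lam\<^sup>2 * m / 2\<close> contribute at most half of the left-hand side and are
  absorbed. The other pairs form \<open>Y\<close>, which gives
  \<open>lam\<^sup>2 * X\<^sup>2 \<le> 2 * Y\<close>. A final AM-GM step with free parameter
  \<open>t\<close> makes the bound linear in \<open>Y\<close>, so that its expectation can be
  taken.\<close>

lemma overlapping_family_sum_le:
  fixes w :: "'a set \<Rightarrow> real"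
  assumes "finite H" and F: "F \<subseteq> H" and w: "\<And>S. S \<in> H \<Longrightarrow> 0 \<le> w S"
    and fin: "\<And>S. S \<in> H \<Longrightarrow> finite S" and size: "\<And>S. S \<in> H \<Longrightarrow> card S = m" and "0 < m"
    and "G \<in> H" and "0 < lam" and meet: "\<And>S. S \<in> F \<Longrightarrow> lam * real m \<le> real (card (G \<inter> S))"
    and "0 < t"
  shows "(\<Sum>S\<in>F. w S) \<le> t / 2 + (\<Sum>S\<in>H. \<Sum>S' | S' \<in> H \<and> lam\<^sup>2 * real m / 2 \<le> real (card (S \<inter> S')).
    w S * w S') / (lam\<^sup>2 * t)"
proof -
  define X where "X = (\<Sum>S\<in>F. w S)"
  define b where "b = lam\<^sup>2 * real m / 2"
  define Y where "Y = (\<Sum>S\<in>H. \<Sum>S' | S' \<in> H \<and> b \<le> real (card (S \<inter> S')). w S * w S')"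
  have finF: "finite F" using assms(1) F finite_subset by blast
  have "(lam * real m * X)\<^sup>2 \<le> real (card G) * (\<Sum>S\<in>F. \<Sum>S'\<in>F. w S * w S' * real (card (S \<inter> S')))"
    unfolding X_def using assms by (intro overlapping_family_pair_sum finF) auto
  \<comment> \<open>Every pair is charged \<open>b\<close>, and pairs with large overlap
    additionally the trivial bound \<open>m\<close>; the first charges add up to
    \<open>b * X\<^sup>2\<close>.\<close>
  also have "(\<Sum>S\<in>F. \<Sum>S'\<in>F. w S * w S' * real (card (S \<inter> S'))) \<le>
      (\<Sum>S\<in>F. \<Sum>S'\<in>F. b * (w S * w S') + real m * (if b \<le> real (card (S \<inter> S')) then w S * w S' else 0))"
  proof (intro sum_mono)
    fix S S' assume "S \<in> F" "S' \<in> F"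
    then have S: "S \<in> H" "S' \<in> H" using F by auto
    have nn: "0 \<le> w S * w S'" using w S by simp
    have "card (S \<inter> S') \<le> m" using card_mono[of S "S \<inter> S'"] fin size S by auto
    then have "w S * w S' * real (card (S \<inter> S')) \<le> w S * w S' * real m" 
      using nn by (intro mult_left_mono) auto
    moreover have "real (card (S \<inter> S')) \<le> b \<Longrightarrow> w S * w S' * real (card (S \<inter> S')) \<le> w S * w S' * b"
      using nn by (intro mult_left_mono) auto
    moreover have "0 \<le> b * (w S * w S')" using nn by (simp add: b_def)
    ultimately show "w S * w S' * real (card (S \<inter> S')) \<le> 
        b * (w S * w S') + real m * (if b \<le> real (card (S \<inter> S')) then w S * w S' else 0)"
      by (auto simp: ac_simps)
  qed
  also have "\<dots> = b * X\<^sup>2 + real m * (\<Sum>S\<in>F. \<Sum>S'\<in>F. if b \<le> real (card (S \<inter> S')) then w S * w S' else 0)"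
    by (simp add: sum.distrib X_def power2_eq_square sum_product flip: sum_distrib_left)
  \<comment> \<open>Enlarging \<open>F\<close> to \<open>H\<close> frees the bound from the guess
    \<open>G\<close>, over which it is averaged later.\<close>
  also have "(\<Sum>S\<in>F. \<Sum>S'\<in>F. if b \<le> real (card (S \<inter> S')) then w S * w S' else 0) \<le>
      (\<Sum>S\<in>H. \<Sum>S'\<in>H. if b \<le> real (card (S \<inter> S')) then w S * w S' else 0)"
    using w F \<open>finite H\<close>
    by (intro order.trans[OF sum_mono[OF sum_mono2] sum_mono2]) (auto intro!: sum_nonneg)
  also have "\<dots> = Y"
    unfolding Y_def using \<open>finite H\<close> by (simp add: sum.inter_filter)
  finally have "(lam * real m * X)\<^sup>2 \<le> real m * (b * X\<^sup>2 + real m * Y)"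
    using size \<open>G \<in> H\<close> by (simp add: mult_left_mono)
  then have "(real m)\<^sup>2 * (lam\<^sup>2 * X\<^sup>2) \<le> (real m)\<^sup>2 * (lam\<^sup>2 * X\<^sup>2 / 2 + Y)"
    by (simp add: b_def power_mult_distrib power2_eq_square field_simps)
  then have "lam\<^sup>2 * X\<^sup>2 \<le> 2 * Y"
    using \<open>0 < m\<close> by (subst (asm) mult_le_cancel_left_pos) auto
  then have "X\<^sup>2 / (2 * t) \<le> Y / (lam\<^sup>2 * t)"
    using \<open>0 < lam\<close> \<open>0 < t\<close> by (simp add: field_simps)
  moreover have "X \<le> t / 2 + X\<^sup>2 / (2 * t)"
  proof -
    have "0 \<le> (X - t)\<^sup>2 / (2 * t)" using \<open>0 < t\<close> by simp
    also have "(X - t)\<^sup>2 / (2 * t) = t / 2 + X\<^sup>2 / (2 * t) - X"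
      using \<open>0 < t\<close> by (simp add: power2_eq_square field_simps)
    finally show ?thesis by simp
  qed
  ultimately show ?thesis by (simp add: X_def Y_def b_def)
qed

section \<open>Bounds for a fixed number of vertices\<close>

locale planted_graph =
  P: prob_space P + Q: prob_space Q for P Q :: "'w measure" +
  fixes n m :: nat and H :: "graph set"
  assumes sets_PQ: "sets P = sets Q"
    and PQ_ac: "absolutely_continuous Q P"
    and H_ne: "H \<noteq> {}"
    and H_sub: "S \<in> H \<Longrightarrow> S \<subseteq> complete_edges n"
    and H_size: "S \<in> H \<Longrightarrow> card S = m"
    and m_pos: "0 < m"
begin

abbreviation E :: graph where "E \<equiv> complete_edges n"
abbreviation r :: "'w \<Rightarrow> ennreal" where "r \<equiv> RN_deriv Q P"
abbreviation W :: "graph \<Rightarrow> (nat set \<Rightarrow> 'w) measure" where "W S \<equiv> weights_law n P Q S"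
abbreviation N :: "(nat set \<Rightarrow> 'w) measure" where "N \<equiv> PiM E (\<lambda>_. Q)"
abbreviation lik :: "graph \<Rightarrow> (nat set \<Rightarrow> 'w) \<Rightarrow> ennreal" where "lik S A \<equiv> \<Prod>e\<in>S. r (A e)"

lemma finite_E [simp]: "finite E"
  by (simp add: complete_edges_def nsets_def)

lemma finite_H [simp]: "finite H"
  using H_sub by (intro finite_subset[of H "Pow E"]) auto

lemma finite_graph: "S \<in> H \<Longrightarrow> finite S"
  using H_sub finite_subset finite_E by blast

lemma card_H_pos: "0 < card H"
  using H_ne by (simp add: card_gt_0_iff)

section \<open>The likelihood ratio of a single edge\<close>

lemma measurable_P_eq [simp]: "measurable P X = measurable Q X"
  by (rule measurable_cong_sets) (auto simp: sets_PQ)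

lemma space_P [simp]: "space P = space Q"
  using sets_PQ by (rule sets_eq_imp_space_eq)

lemma density_r: "density Q r = P"
  by (rule Q.density_RN_deriv) (auto simp: sets_PQ PQ_ac)

lemma nn_integral_r: "(\<integral>\<^sup>+ x. r x \<partial>Q) = 1"
proof -
  have "(\<integral>\<^sup>+ x. r x \<partial>Q) = emeasure (density Q r) (space Q)"
    by (simp add: emeasure_density cong: nn_integral_cong)
  then show ?thesis
    unfolding density_r using P.emeasure_space_1 by simp
qed

lemma r_finite: "AE x in Q. r x \<noteq> \<infinity>"
  by (rule Q.RN_deriv_finite) (auto simp: sets_PQ PQ_ac intro: P.sigma_finite_measure_axioms)

lemma r_finite_P: "AE x in P. r x \<noteq> \<infinity>"
  using absolutely_continuous_AE[OF sets_PQ PQ_ac r_finite] .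

text \<open>A measure with density \<open>r\<close> gives no mass to the zeros of \<open>r\<close>;
  under \<open>Q\<close> they may well have positive mass.\<close>

lemma r_pos_P: "AE x in P. r x \<noteq> 0"
proof -
  have "AE x in density Q r. r x \<noteq> 0"
    by (subst AE_density) auto
  then show ?thesis unfolding density_r .
qed

section \<open>Product laws of the weights\<close>

lemma prod_law: "product_prob_space (\<lambda>e. if e \<in> S then P else Q)"
  by (intro product_prob_spaceI) (simp_all add: P.prob_space_axioms Q.prob_space_axioms)

lemma sets_W [measurable_cong]: "sets (W S) = sets N"
  unfolding weights_law_def by (intro sets_PiM_cong) (simp_all add: sets_PQ)

lemma space_W [simp]: "space (W S) = space N"
  using sets_W by (rule sets_eq_imp_space_eq)

lemma prob_space_W: "prob_space (W S)"
  unfolding weights_law_def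
  by (intro prob_space_PiM) (simp add: P.prob_space_axioms Q.prob_space_axioms)

lemma prob_space_N: "prob_space N"
  by (intro prob_space_PiM) (simp add: Q.prob_space_axioms)

lemma r_comp_measurable [measurable]: "e \<in> E \<Longrightarrow> (\<lambda>A. r (A e)) \<in> borel_measurable N"
  by measurable

lemma lik_measurable: "S \<subseteq> E \<Longrightarrow> lik S \<in> borel_measurable N"
  by (intro borel_measurable_prod_ennreal) auto

text \<open>Independence of the coordinates, after padding the product over \<open>T\<close> to one
  over all of \<open>E\<close> by factors 1, whose integral is 1.\<close>

lemma nn_integral_W_prod:
  assumes "T \<subseteq> E" and g: "g \<in> borel_measurable Q"
  shows "(\<integral>\<^sup>+ A. (\<Prod>e\<in>T. g (A e)) \<partial>W S) = (\<Prod>e\<in>T. \<integral>\<^sup>+ x. g x \<partial>(if e \<in> S then P else Q))"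
proof -
  interpret W: product_prob_space "\<lambda>e. if e \<in> S then P else Q" E by (rule prod_law)
  have "(\<integral>\<^sup>+ A. (\<Prod>e\<in>T. g (A e)) \<partial>W S) = (\<integral>\<^sup>+ A. (\<Prod>e\<in>E. (\<lambda>x. if e \<in> T then g x else 1) (A e)) \<partial>W S)"
    using assms(1) by (simp add: prod.If_cases Int_absorb1)
  also have "\<dots> = (\<Prod>e\<in>E. \<integral>\<^sup>+ x. (if e \<in> T then g x else 1) \<partial>(if e \<in> S then P else Q))"
    unfolding weights_law_def using g by (intro W.product_nn_integral_prod) auto
  also have "\<dots> = (\<Prod>e\<in>E. if e \<in> T then \<integral>\<^sup>+ x. g x \<partial>(if e \<in> S then P else Q) else 1)"
    by (intro prod.cong) (auto simp: P.emeasure_space_1[unfolded space_P] Q.emeasure_space_1)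
  also have "\<dots> = (\<Prod>e\<in>T. \<integral>\<^sup>+ x. g x \<partial>(if e \<in> S then P else Q))"
    using assms(1) by (simp add: prod.If_cases Int_absorb1)
  finally show ?thesis .
qed

text \<open>A measure that agrees with the product measure on boxes is equal to it, and over a box
  the integral of \<open>lik S\<close> factors into one integral per edge.\<close>

lemma W_eq_density:
  assumes "S \<subseteq> E"
  shows "W S = density N (lik S)"
proof -
  interpret W: product_prob_space "\<lambda>e. if e \<in> S then P else Q" E by (rule prod_law)
  interpret Q_prod: product_prob_space "\<lambda>_. Q" E
    by (intro product_prob_spaceI) (simp add: Q.prob_space_axioms)
  have "density N (lik S) = PiM E (\<lambda>e. if e \<in> S then P else Q)"
  proof (rule W.PiM_eqI)
    show "sets (density N (lik S)) = sets (PiM E (\<lambda>e. if e \<in> S then P else Q))"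
      using sets_W[of S] by (simp add: weights_law_def)
    fix A assume A_sets: "\<And>e. e \<in> E \<Longrightarrow> A e \<in> sets (if e \<in> S then P else Q)"
    have A: "A e \<in> sets Q" if "e \<in> E" for e
      using A_sets[OF that] by (cases "e \<in> S") (simp_all add: sets_PQ)
    have "emeasure (density N (lik S)) (Pi\<^sub>E E A) = (\<integral>\<^sup>+ X. lik S X * indicator (Pi\<^sub>E E A) X \<partial>N)"
      using A assms by (intro emeasure_density lik_measurable sets_PiM_I_finite) auto
    also have "\<dots> = (\<integral>\<^sup>+ X. (\<Prod>e\<in>E. (\<lambda>x. (if e \<in> S then r x else 1) * indicator (A e) x) (X e)) \<partial>N)"
    proof (intro nn_integral_cong)
      fix X assume X: "X \<in> space N"
      have "indicator (Pi\<^sub>E E A) X = (\<Prod>e\<in>E. indicator (A e) (X e) :: ennreal)"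
      proof (cases "X \<in> Pi\<^sub>E E A")
        case True
        then have "\<And>e. e \<in> E \<Longrightarrow> X e \<in> A e" by (rule PiE_mem)
        with True show ?thesis by simp
      next
        case False
        \<comment> \<open>Points of \<open>N\<close> are extensional, so lying outside the box means
          violating it in some coordinate.\<close>
        moreover have "X \<in> extensional E" using X by (simp add: space_PiM PiE_def)
        ultimately obtain e where "e \<in> E" "X e \<notin> A e" by (auto simp: PiE_def)
        then have "(\<Prod>e\<in>E. indicator (A e) (X e) :: ennreal) = 0"
          by (intro prod_zero) (auto intro!: bexI[of _ e])
        with False show ?thesis by simp
      qed
      then show "lik S X * indicator (Pi\<^sub>E E A) X =
          (\<Prod>e\<in>E. (\<lambda>x. (if e \<in> S then r x else 1) * indicator (A e) x) (X e))"
        using assms by (simp add: prod.distrib prod.If_cases Int_absorb1)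
    qed
    also have "\<dots> = (\<Prod>e\<in>E. \<integral>\<^sup>+ x. (if e \<in> S then r x else 1) * indicator (A e) x \<partial>Q)"
      using A by (intro Q_prod.product_nn_integral_prod) auto
    also have "\<dots> = (\<Prod>e\<in>E. emeasure (if e \<in> S then P else Q) (A e))"
    proof (intro prod.cong refl)
      fix e assume "e \<in> E"
      then have [measurable]: "A e \<in> sets Q" by (rule A)
      have "emeasure (density Q r) (A e) = (\<integral>\<^sup>+ x. r x * indicator (A e) x \<partial>Q)"
        by (intro emeasure_density) auto
      then show "(\<integral>\<^sup>+ x. (if e \<in> S then r x else 1) * indicator (A e) x \<partial>Q)
          = emeasure (if e \<in> S then P else Q) (A e)"
        by (simp add: density_r)
    qed
    finally show "emeasure (density N (lik S)) (Pi\<^sub>E E A) = (\<Prod>e\<in>E. emeasure (if e \<in> S then P else Q) (A e))" .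
  qed simp
  then show ?thesis by (simp add: weights_law_def)
qed

lemma nn_integral_W:
  assumes "S \<subseteq> E" "f \<in> borel_measurable N"
  shows "(\<integral>\<^sup>+ A. f A \<partial>W S) = (\<integral>\<^sup>+ A. lik S A * f A \<partial>N)"
  using assms by (simp add: W_eq_density nn_integral_density lik_measurable)

lemma AE_component:
  assumes "e \<in> E" "AE x in (if e \<in> S then P else Q). p x"
  shows "AE A in W S. p (A e)"
  unfolding weights_law_def
  by (rule AE_PiM_component) (use assms in \<open>auto simp: P.prob_space_axioms Q.prob_space_axioms\<close>)

text \<open>This collects the null sets that the later pointwise arguments discard. Off the planted
  graph \<open>r (A e) = 0\<close> may have positive probability, so positivity is claimed for
  planted edges only.\<close>

lemma AE_regular: "AE A in W S. (\<forall>e\<in>E. r (A e) \<noteq> \<infinity>) \<and> (\<forall>e\<in>S \<inter> E. r (A e) \<noteq> 0)"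
proof -
  have "AE A in W S. \<forall>e\<in>E. r (A e) \<noteq> \<infinity>"
    using r_finite r_finite_P by (intro AE_finite_allI finite_E AE_component) auto
  moreover have "AE A in W S. \<forall>e\<in>S \<inter> E. r (A e) \<noteq> 0"
    using r_pos_P by (intro AE_finite_allI finite_Int disjI2 finite_E AE_component) auto
  ultimately show ?thesis by eventually_elim simp
qed

section \<open>Tail and moment bounds for likelihood products\<close>

text \<open>Markov's inequality, where by independence the mean of the product is the product of the
  means, each at most \<open>B\<close>.\<close>

lemma markov_W:
  assumes "T \<subseteq> E" and g [measurable]: "g \<in> borel_measurable Q" and "0 < c"
    and B: "\<And>e. e \<in> T \<Longrightarrow> (\<integral>\<^sup>+ x. g x \<partial>(if e \<in> S then P else Q)) \<le> ennreal B" and "0 \<le> B"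
  shows "emeasure (W S) {A\<in>space N. ennreal c \<le> (\<Prod>e\<in>T. g (A e))} \<le> ennreal (B ^ card T / c)"
proof -
  have "T \<subseteq> E" by fact
  then have [measurable]: "(\<lambda>A. \<Prod>e\<in>T. g (A e)) \<in> borel_measurable N"
    by (intro borel_measurable_prod_ennreal) auto
  \<comment> \<open>Rescaling moves the threshold to 1, the form of
    \<open>nn_integral_Markov_inequality\<close>.\<close>
  have "{A\<in>space N. ennreal c \<le> (\<Prod>e\<in>T. g (A e))} \<subseteq>
      {A\<in>space N. 1 \<le> ennreal (1 / c) * (\<Prod>e\<in>T. g (A e))}"
  proof safe
    fix A assume "ennreal c \<le> (\<Prod>e\<in>T. g (A e))"
    then have "ennreal (1 / c) * ennreal c \<le> ennreal (1 / c) * (\<Prod>e\<in>T. g (A e))"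
      by (rule mult_left_mono) simp
    then show "1 \<le> ennreal (1 / c) * (\<Prod>e\<in>T. g (A e))"
      using \<open>0 < c\<close> by (simp flip: ennreal_mult)
  qed
  then have "emeasure (W S) {A\<in>space N. ennreal c \<le> (\<Prod>e\<in>T. g (A e))} \<le>
     emeasure (W S) {A\<in>space N. 1 \<le> ennreal (1 / c) * (\<Prod>e\<in>T. g (A e))}"
    by (intro emeasure_mono) (auto simp: sets_W)
  also have "\<dots> \<le> ennreal (1 / c) * (\<integral>\<^sup>+ A. (\<Prod>e\<in>T. g (A e)) * indicator (space N) A \<partial>W S)"
    by (intro nn_integral_Markov_inequality) (auto simp: sets_W)
  also have "(\<integral>\<^sup>+ A. (\<Prod>e\<in>T. g (A e)) * indicator (space N) A \<partial>W S) = (\<integral>\<^sup>+ A. (\<Prod>e\<in>T. g (A e)) \<partial>W S)"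
    by (intro nn_integral_cong) simp
  also have "\<dots> = (\<Prod>e\<in>T. \<integral>\<^sup>+ x. g x \<partial>(if e \<in> S then P else Q))"
    using assms by (intro nn_integral_W_prod)
  also have "\<dots> \<le> (\<Prod>e\<in>T. ennreal B)"
    using B by (intro prod_mono_ennreal)
  also have "ennreal (1 / c) * (\<Prod>e\<in>T. ennreal B) = ennreal (B ^ card T / c)"
    using \<open>0 < c\<close> \<open>0 \<le> B\<close> by (simp add: ennreal_power flip: ennreal_mult)
  finally show ?thesis by (auto simp: mult_left_mono)
qed

abbreviation \<rho> :: "'w \<Rightarrow> real" where "\<rho> x \<equiv> enn2real (r x)"

lemma lik_eq_ennreal:
  assumes "T \<subseteq> E" "\<forall>e\<in>E. r (A e) \<noteq> \<infinity>"
  shows "lik T A = ennreal (\<Prod>e\<in>T. \<rho> (A e))"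
proof -
  have "lik T A = (\<Prod>e\<in>T. ennreal (\<rho> (A e)))"
    using assms by (intro prod.cong) (auto simp: less_top)
  then show ?thesis by (simp add: prod_ennreal)
qed

lemma AE_N_finite: "AE A in N. \<forall>e\<in>E. r (A e) \<noteq> \<infinity>"
proof -
  have "W {} = N" by (simp add: weights_law_def)
  from AE_regular[of "{}", unfolded this] show ?thesis by eventually_elim simp
qed

text \<open>Phrasing the event through the power \<open>s\<close> covers both tails: with
  \<open>p\<close> the product, it says \<open>p \<ge> exp \<tau>\<close> for \<open>s > 0\<close>,
  and \<open>0 < p \<le> exp \<tau>\<close> for \<open>s < 0\<close>, where
  \<open>0 powr s = 0\<close> leaves out \<open>p = 0\<close>.\<close>

lemma chernoff_W:
  assumes "S \<subseteq> E" "T \<subseteq> S"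
    and "(\<integral>\<^sup>+ x. ennreal (\<rho> x powr s) \<partial>P) \<le> ennreal B" "0 \<le> B"
  shows "emeasure (W S) {A\<in>space N. exp (s * \<tau>) \<le> (\<Prod>e\<in>T. \<rho> (A e)) powr s}
    \<le> ennreal (B ^ card T / exp (s * \<tau>))"
proof -
  have "(\<Prod>e\<in>T. ennreal (\<rho> (A e) powr s)) = ennreal ((\<Prod>e\<in>T. \<rho> (A e)) powr s)" for A
    by (simp add: prod_ennreal prod_powr_distrib)
  then have eq: "{A\<in>space N. exp (s * \<tau>) \<le> (\<Prod>e\<in>T. \<rho> (A e)) powr s} =
      {A\<in>space N. ennreal (exp (s * \<tau>)) \<le> (\<Prod>e\<in>T. ennreal (\<rho> (A e) powr s))}"
    by simp
  show ?thesis
    unfolding eq using assms by (intro markov_W) auto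
qed

text \<open>No edge of \<open>T\<close> is planted, so every factor has mean one by
  \<open>nn_integral_r\<close>, and hence so has the product.\<close>

lemma markov_null:
  assumes "T \<subseteq> E" "T \<inter> S = {}"
  shows "emeasure (W S) {A\<in>space N. ennreal (exp \<tau>) \<le> lik T A} \<le> ennreal (exp (- \<tau>))"
proof -
  have "emeasure (W S) {A\<in>space N. ennreal (exp \<tau>) \<le> lik T A} \<le> ennreal (1 ^ card T / exp \<tau>)"
    using assms by (intro markov_W) (auto simp: nn_integral_r)
  then show ?thesis by (simp add: exp_minus field_simps)
qed

text \<open>The factor \<open>lik S\<close> turns \<open>N\<close> into \<open>W S\<close>. Under
  \<open>W S\<close> an edge of \<open>S'\<close> has mean at most \<open>B\<close> if it also lies
  in \<open>S\<close>, and mean one otherwise, so only the overlap counts.\<close>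

lemma second_moment:
  assumes "S \<subseteq> E" "S' \<subseteq> E" and B: "(\<integral>\<^sup>+ x. ennreal (\<rho> x) \<partial>P) \<le> ennreal B" "0 \<le> B"
  shows "(\<integral>\<^sup>+ A. lik S A * lik S' A \<partial>N) \<le> ennreal (B ^ card (S \<inter> S'))"
proof -
  have rP: "(\<integral>\<^sup>+ x. r x \<partial>P) \<le> ennreal B"
    using r_finite_P by (intro order.trans[OF _ B(1)] nn_integral_mono_AE) (auto simp: less_top)
  have "(\<integral>\<^sup>+ A. lik S A * lik S' A \<partial>N) = (\<integral>\<^sup>+ A. lik S' A \<partial>W S)"
    using assms by (intro nn_integral_W[symmetric] lik_measurable)
  also have "\<dots> = (\<Prod>e\<in>S'. \<integral>\<^sup>+ x. r x \<partial>(if e \<in> S then P else Q))"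
    using assms by (intro nn_integral_W_prod) auto
  also have "\<dots> \<le> (\<Prod>e\<in>S'. if e \<in> S then ennreal B else 1)"
    using rP nn_integral_r by (intro prod_mono_ennreal) auto
  also have "\<dots> = ennreal (B ^ card (S \<inter> S'))"
    using B(2) finite_subset[OF \<open>S' \<subseteq> E\<close>]
    by (simp add: prod.If_cases ennreal_power Int_commute flip: Int_def)
  finally show ?thesis .
qed

section \<open>Joint law of the hidden graph and the estimate\<close>

context
  fixes K :: "(nat set \<Rightarrow> 'w) \<Rightarrow> graph measure"
  assumes K: "K \<in> N \<rightarrow>\<^sub>M prob_algebra (count_space H)"
begin

lemma kernel_subprob: "K \<in> N \<rightarrow>\<^sub>M subprob_algebra (count_space H)"
  using K by (rule measurable_prob_algebraD)

lemma space_W_ne: "space (W S) \<noteq> {}"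
  using prob_space.not_empty[OF prob_space_W] .

lemma return_kernel:
  "(\<lambda>G. return (count_space UNIV) (S, G)) \<in> count_space H \<rightarrow>\<^sub>M subprob_algebra (count_space UNIV :: (graph \<times> graph) measure)"
  by (auto intro!: subprob_space_return simp: space_subprob_algebra)

lemma estimate_kernel:
  "(\<lambda>A. K A \<bind> (\<lambda>G. return (count_space UNIV) (S, G))) \<in> W S \<rightarrow>\<^sub>M subprob_algebra (count_space UNIV)"
proof (rule measurable_bind2[OF _ return_kernel])
  show "K \<in> W S \<rightarrow>\<^sub>M subprob_algebra (count_space H)"
    using kernel_subprob by (simp cong: measurable_cong_sets add: sets_W)
qed

lemma planted_kernel:
  "(\<lambda>S. W S \<bind> (\<lambda>A. K A \<bind> (\<lambda>G. return (count_space UNIV) (S, G))))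
    \<in> measure_pmf (pmf_of_set H) \<rightarrow>\<^sub>M subprob_algebra (count_space UNIV)"
proof -
  let ?U = "count_space UNIV :: (graph \<times> graph) measure"
  let ?ret = "\<lambda>S G. return ?U (S, G)"
  have "subprob_space (W S \<bind> (\<lambda>A. K A \<bind> ?ret S))" for S
    using prob_space_W by (intro subprob_space_bind[OF _ estimate_kernel] prob_space_imp_subprob_space)
  moreover have "sets (W S \<bind> (\<lambda>A. K A \<bind> ?ret S)) = sets ?U" for S
    by (intro sets_bind space_W_ne sets_kernel[OF estimate_kernel]) simp
  ultimately show ?thesis by (auto simp: space_subprob_algebra)
qed

lemma sets_recovery_law: "sets (recovery_law n H P Q K) = UNIV"
  unfolding recovery_law_def
  by (subst sets_bind[OF sets_kernel[OF planted_kernel]]) auto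

text \<open>All bounds on the recovery probability start from this formula: as \<open>H\<close> is
  finite, the monadic binds reduce to finite sums over the hidden graph and the estimate, and only
  the integral over the weights remains.\<close>

lemma emeasure_recovery_law:
  "emeasure (recovery_law n H P Q K) X =
    (\<Sum>S\<in>H. \<integral>\<^sup>+ A. (\<Sum>G | G \<in> H \<and> (S, G) \<in> X. emeasure (K A) {G}) \<partial>W S) / of_nat (card H)"
proof -
  let ?U = "count_space UNIV :: (graph \<times> graph) measure"
  let ?ret = "\<lambda>S G. return ?U (S, G)"
  have KA: "emeasure (K A \<bind> ?ret S) X = (\<Sum>G | G \<in> H \<and> (S, G) \<in> X. emeasure (K A) {G})"
    if A: "A \<in> space N" for A S
  proof -
    have s: "sets (K A) = sets (count_space H)" by (rule sets_kernel[OF kernel_subprob A])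
    have sp: "space (K A) = H" using sets_eq_imp_space_eq[OF s] by simp
    have ret': "?ret S \<in> K A \<rightarrow>\<^sub>M subprob_algebra ?U"
      unfolding measurable_cong_sets[OF s refl] by (rule return_kernel)
    have "emeasure (K A \<bind> ?ret S) X = (\<integral>\<^sup>+ G. emeasure (?ret S G) X \<partial>K A)"
      using H_ne sp by (intro emeasure_bind[OF _ ret']) auto
    also have "\<dots> = (\<integral>\<^sup>+ G. indicator {G. G \<in> H \<and> (S, G) \<in> X} G \<partial>K A)"
      using sp by (intro nn_integral_cong) (auto simp: indicator_def)
    also have "\<dots> = emeasure (K A) {G. G \<in> H \<and> (S, G) \<in> X}"
      by (intro nn_integral_indicator) (auto simp: s)
    also have "\<dots> = (\<Sum>G | G \<in> H \<and> (S, G) \<in> X. emeasure (K A) {G})"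
      by (intro emeasure_eq_sum_singleton) (auto simp: s)
    finally show ?thesis .
  qed
  have "emeasure (recovery_law n H P Q K) X =
      (\<integral>\<^sup>+ S. emeasure (W S \<bind> (\<lambda>A. K A \<bind> ?ret S)) X \<partial>measure_pmf (pmf_of_set H))"
    unfolding recovery_law_def by (rule emeasure_bind[OF _ planted_kernel]) auto
  also have "\<dots> = (\<Sum>S\<in>H. emeasure (W S \<bind> (\<lambda>A. K A \<bind> ?ret S)) X) / of_nat (card H)"
    using H_ne by (simp add: nn_integral_pmf_of_set ennreal_of_nat_eq_real_of_nat)
  also have "(\<Sum>S\<in>H. emeasure (W S \<bind> (\<lambda>A. K A \<bind> ?ret S)) X) =
      (\<Sum>S\<in>H. \<integral>\<^sup>+ A. (\<Sum>G | G \<in> H \<and> (S, G) \<in> X. emeasure (K A) {G}) \<partial>W S)"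
    by (intro sum.cong refl, subst emeasure_bind[OF space_W_ne estimate_kernel]) (auto intro!: nn_integral_cong simp: KA)
  finally show ?thesis .
qed

lemma kernel_measurable: "(\<lambda>A. emeasure (K A) {G}) \<in> borel_measurable N"
proof (cases "G \<in> H")
  case True
  then show ?thesis
    by (intro measurable_emeasure_kernel[OF kernel_subprob]) auto
next
  \<comment> \<open>Outside \<open>H\<close> the singleton is not a measurable set of
    \<open>K A\<close>, and \<open>emeasure\<close> takes its default value 0.\<close>
  case False
  then have "emeasure (K A) {G} = 0" if "A \<in> space N" for A
    using sets_kernel[OF kernel_subprob that] by (intro emeasure_notin_sets) auto
  then show ?thesis by (simp cong: measurable_cong)
qed

lemma kernel_sum:
  assumes "A \<in> space N"
  shows "(\<Sum>G\<in>H. emeasure (K A) {G}) = 1"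
proof -
  have KA: "prob_space (K A)" "sets (K A) = sets (count_space H)"
    using measurable_space[OF K assms] by (auto simp: space_prob_algebra)
  then have "(\<Sum>G\<in>H. emeasure (K A) {G}) = emeasure (K A) H"
    by (intro emeasure_eq_sum_singleton[symmetric]) auto
  also have "\<dots> = 1"
    using prob_space.emeasure_space_1[OF KA(1)] sets_eq_imp_space_eq[OF KA(2)] by simp
  finally show ?thesis .
qed

lemma kernel_le_1:
  assumes "A \<in> space N"
  shows "(\<Sum>G | G \<in> H \<and> p G. emeasure (K A) {G}) \<le> 1"
  unfolding kernel_sum[OF assms, symmetric] by (intro sum_mono2) auto

lemma prob_space_recovery_law: "prob_space (recovery_law n H P Q K)"
proof
  have "emeasure (recovery_law n H P Q K) UNIV = (\<Sum>S\<in>H. \<integral>\<^sup>+ A. 1 \<partial>W S) / of_nat (card H)"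
    unfolding emeasure_recovery_law
    by (intro arg_cong2[where f = "(/)"] sum.cong nn_integral_cong refl) (simp add: kernel_sum)
  also have "\<dots> = of_nat (card H) / of_nat (card H)"
    using prob_space.emeasure_space_1[OF prob_space_W] by simp
  also have "\<dots> = 1"
    using card_H_pos by (intro ennreal_divide_self) (auto simp: ennreal_of_nat_eq_real_of_nat)
  finally show "emeasure (recovery_law n H P Q K) (space (recovery_law n H P Q K)) = 1"
    using sets_eq_imp_space_eq[of "recovery_law n H P Q K" "count_space UNIV"] by (simp add: sets_recovery_law)
qed

lemma recovery_prob_le:
  assumes "emeasure (recovery_law n H P Q K) X \<le> ennreal b" "0 \<le> b"
  shows "measure (recovery_law n H P Q K) X \<le> b"
  using assms by (simp add: measure_def enn2real_leI)

end

section \<open>Bounds on the success of any estimator\<close>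

text \<open>Where the likelihood ratio is below \<open>exp \<tau>\<close>, passing from
  \<open>W S\<close> to \<open>N\<close> costs at most a factor \<open>exp \<tau>\<close>, and under
  \<open>N\<close> the estimate carries no information on \<open>S\<close>, so that
  \<open>\<nu>\<close> bounds its success. The Chernoff term pays for the remaining event.\<close>

lemma recovery_le_change_of_measure:
  assumes K: "K \<in> N \<rightarrow>\<^sub>M prob_algebra (count_space H)"
    and s: "0 < s" and B: "(\<integral>\<^sup>+ x. ennreal (\<rho> x powr s) \<partial>P) \<le> ennreal B" "0 \<le> B"
    and null: "\<And>G. G \<in> H \<Longrightarrow> real (card {S\<in>H. (S, G) \<in> X}) \<le> \<nu> * real (card H)" and "0 \<le> \<nu>"
  shows "emeasure (recovery_law n H P Q K) X \<le> ennreal (B ^ m / exp (s * \<tau>) + exp \<tau> * \<nu>)"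
proof -
  define k where "k A G = emeasure (K A) {G}" for A G
  define \<kappa> where "\<kappa> S A = (\<Sum>G | G \<in> H \<and> (S, G) \<in> X. k A G)" for S A
  \<comment> \<open>As \<open>s > 0\<close>, this is the event that the likelihood ratio reaches
    \<open>exp \<tau>\<close>.\<close>
  define bad where "bad S = {A\<in>space N. exp (s * \<tau>) \<le> (\<Prod>e\<in>S. \<rho> (A e)) powr s}" for S
  have [measurable]: "(\<lambda>A. k A G) \<in> borel_measurable N" for G
    unfolding k_def by (rule kernel_measurable[OF K])
  then have \<kappa>_meas [measurable]: "\<kappa> S \<in> borel_measurable N" for S
    unfolding \<kappa>_def by measurable
  have \<kappa>_le_1: "\<kappa> S A \<le> 1" if "A \<in> space N" for S A
    unfolding \<kappa>_def k_def by (rule kernel_le_1[OF K that])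
  have bad_sets [measurable]: "bad S \<in> sets N" if "S \<in> H" for S
  proof -
    have [measurable]: "e \<in> S \<Longrightarrow> (\<lambda>A. r (A e)) \<in> borel_measurable N" for e
      using that H_sub by (intro r_comp_measurable) auto
    show ?thesis unfolding bad_def by measurable
  qed
  have one: "(\<integral>\<^sup>+ A. \<kappa> S A \<partial>W S) \<le> ennreal (B ^ m / exp (s * \<tau>)) + ennreal (exp \<tau>) * (\<integral>\<^sup>+ A. \<kappa> S A \<partial>N)"
    if S: "S \<in> H" for S
  proof -
    note [measurable] = bad_sets[OF S]
    have "(\<integral>\<^sup>+ A. \<kappa> S A \<partial>W S) \<le> (\<integral>\<^sup>+ A. indicator (bad S) A + indicator (space N - bad S) A * \<kappa> S A \<partial>W S)"
      using \<kappa>_le_1 by (intro nn_integral_mono) (auto simp: indicator_def)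
    also have "\<dots> = emeasure (W S) (bad S) + (\<integral>\<^sup>+ A. indicator (space N - bad S) A * \<kappa> S A \<partial>W S)"
      by (subst nn_integral_add) (auto simp: sets_W)
    also have "\<dots> = emeasure (W S) (bad S) + (\<integral>\<^sup>+ A. lik S A * (indicator (space N - bad S) A * \<kappa> S A) \<partial>N)"
      using H_sub[OF S] by (subst nn_integral_W) auto
    also have "(\<integral>\<^sup>+ A. lik S A * (indicator (space N - bad S) A * \<kappa> S A) \<partial>N) \<le>
        (\<integral>\<^sup>+ A. ennreal (exp \<tau>) * \<kappa> S A \<partial>N)"
    proof (rule nn_integral_mono_AE)
      show "AE A in N. lik S A * (indicator (space N - bad S) A * \<kappa> S A) \<le> ennreal (exp \<tau>) * \<kappa> S A"
        using AE_N_finite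
      proof eventually_elim
        case (elim A)
        show ?case
        proof (cases "A \<in> space N - bad S")
          case True
          then have "(\<Prod>e\<in>S. \<rho> (A e)) powr s < exp \<tau> powr s"
            by (auto simp: bad_def exp_powr_real mult.commute not_le)
          then have "(\<Prod>e\<in>S. \<rho> (A e)) < exp \<tau>"
            using s powr_mono2[of s "exp \<tau>" "\<Prod>e\<in>S. \<rho> (A e)"] by fastforce
          then have "lik S A \<le> ennreal (exp \<tau>)"
            using lik_eq_ennreal[OF H_sub[OF S] elim] by (simp add: ennreal_leI)
          with True show ?thesis by (simp add: mult_right_mono)
        qed simp
      qed
    qed
    also have "(\<integral>\<^sup>+ A. ennreal (exp \<tau>) * \<kappa> S A \<partial>N) = ennreal (exp \<tau>) * (\<integral>\<^sup>+ A. \<kappa> S A \<partial>N)"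
      by (rule nn_integral_cmult) measurable
    also have "emeasure (W S) (bad S) \<le> ennreal (B ^ card S / exp (s * \<tau>))"
      unfolding bad_def using H_sub[OF S] B by (intro chernoff_W) auto
    finally show ?thesis by (simp add: H_size[OF S] add_right_mono add_left_mono)
  qed
  have "(\<Sum>S\<in>H. \<integral>\<^sup>+ A. \<kappa> S A \<partial>N) = (\<integral>\<^sup>+ A. (\<Sum>S\<in>H. \<kappa> S A) \<partial>N)"
    by (rule nn_integral_sum[symmetric]) measurable
  also have "\<dots> \<le> (\<integral>\<^sup>+ A. ennreal (\<nu> * card H) \<partial>N)"
  proof (rule nn_integral_mono)
    fix A assume A: "A \<in> space N"
    have "(\<Sum>S\<in>H. \<kappa> S A) = (\<Sum>S\<in>H. \<Sum>G\<in>H. if (S, G) \<in> X then k A G else 0)"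
      by (simp add: \<kappa>_def sum.inter_filter)
    \<comment> \<open>The weight \<open>k A G\<close> does not depend on \<open>S\<close>, so for
      each guess \<open>G\<close> the hypothesis \<open>null\<close> counts the hidden graphs for
      which it lies in \<open>X\<close>.\<close>
    also have "\<dots> = (\<Sum>G\<in>H. \<Sum>S\<in>H. if (S, G) \<in> X then k A G else 0)"
      by (rule sum.swap)
    also have "\<dots> = (\<Sum>G\<in>H. of_nat (card {S\<in>H. (S, G) \<in> X}) * k A G)"
      by (simp flip: sum.inter_filter)
    also have "\<dots> \<le> (\<Sum>G\<in>H. ennreal (\<nu> * card H) * k A G)"
    proof (intro sum_mono mult_right_mono)
      fix G assume "G \<in> H"
      from null[OF this] show "of_nat (card {S\<in>H. (S, G) \<in> X}) \<le> ennreal (\<nu> * card H)"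
        unfolding ennreal_of_nat_eq_real_of_nat by (rule ennreal_leI)
    qed simp
    also have "\<dots> = ennreal (\<nu> * card H)"
      using kernel_sum[OF K A] by (simp add: k_def flip: sum_distrib_left)
    finally show "(\<Sum>S\<in>H. \<kappa> S A) \<le> ennreal (\<nu> * card H)" .
  qed
  also have "\<dots> = ennreal (\<nu> * card H)"
    using prob_space.emeasure_space_1[OF prob_space_N] by simp
  finally have sum_N: "(\<Sum>S\<in>H. \<integral>\<^sup>+ A. \<kappa> S A \<partial>N) \<le> ennreal (\<nu> * card H)" .
  have "(\<Sum>S\<in>H. \<integral>\<^sup>+ A. \<kappa> S A \<partial>W S) \<le>
      (\<Sum>S\<in>H. ennreal (B ^ m / exp (s * \<tau>)) + ennreal (exp \<tau>) * (\<integral>\<^sup>+ A. \<kappa> S A \<partial>N))"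
    by (intro sum_mono one)
  also have "\<dots> = of_nat (card H) * ennreal (B ^ m / exp (s * \<tau>)) + ennreal (exp \<tau>) * (\<Sum>S\<in>H. \<integral>\<^sup>+ A. \<kappa> S A \<partial>N)"
    by (simp add: sum.distrib sum_distrib_left)
  also have "\<dots> \<le> of_nat (card H) * ennreal (B ^ m / exp (s * \<tau>)) + ennreal (exp \<tau>) * ennreal (\<nu> * card H)"
    using sum_N by (intro add_left_mono mult_left_mono) auto
  also have "\<dots> = ennreal (real (card H) * (B ^ m / exp (s * \<tau>) + exp \<tau> * \<nu>))"
    using B(2) \<open>0 \<le> \<nu>\<close>
    by (simp add: ennreal_of_nat_eq_real_of_nat ac_simps distrib_left flip: ennreal_mult ennreal_plus)
  finally have "(\<Sum>S\<in>H. \<integral>\<^sup>+ A. \<kappa> S A \<partial>W S) / of_nat (card H) \<le>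
      ennreal (real (card H) * (B ^ m / exp (s * \<tau>) + exp \<tau> * \<nu>)) / of_nat (card H)"
    by (rule divide_right_mono_ennreal)
  also have "\<dots> = ennreal (B ^ m / exp (s * \<tau>) + exp \<tau> * \<nu>)"
    using H_ne B(2) \<open>0 \<le> \<nu>\<close>
    by (simp add: ennreal_of_nat_eq_real_of_nat divide_ennreal card_gt_0_iff)
  finally show ?thesis
    unfolding emeasure_recovery_law[OF K] by (simp add: \<kappa>_def k_def)
qed

text \<open>For fixed weights, \<open>overlapping_family_sum_le\<close> bounds the total likelihood
  of the graphs that meet a guess in many edges by the pair sum \<open>Y\<close>. The null
  expectation of \<open>Y\<close> is then controlled pair by pair through
  \<open>second_moment\<close>.\<close>

lemma recovery_le_second_moment:
  assumes K: "K \<in> N \<rightarrow>\<^sub>M prob_algebra (count_space H)"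
    and B: "(\<integral>\<^sup>+ x. ennreal (\<rho> x) \<partial>P) \<le> ennreal B" "0 \<le> B"
    and "0 < lam" "0 < t"
    and V: "\<And>S. S \<in> H \<Longrightarrow> (\<Sum>S' | S' \<in> H \<and> lam\<^sup>2 * real m / 2 \<le> real (card (S \<inter> S')). B ^ card (S \<inter> S'))
      \<le> V * real (card H)" and "0 \<le> V"
  shows "emeasure (recovery_law n H P Q K) {(S, G). lam * real m \<le> real (card (G \<inter> S))}
    \<le> ennreal (t / 2 + V / (lam\<^sup>2 * t))"
proof -
  define X where "X = {(S, G). lam * real m \<le> real (card (G \<inter> S :: graph))}"
  define M where "M = real (card H)"
  define I where "I S = {S'. S' \<in> H \<and> lam\<^sup>2 * real m / 2 \<le> real (card (S \<inter> S'))}" for S :: graph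
  define k where "k A G = emeasure (K A) {G}" for A G
  define \<kappa> where "\<kappa> S A = (\<Sum>G | G \<in> H \<and> (S, G) \<in> X. k A G)" for S A
  \<comment> \<open>These are the coefficients of \<open>overlapping_family_sum_le\<close> with
    \<open>t * M\<close> in place of \<open>t\<close>: under the null law the total likelihood of
    \<open>H\<close> has mean \<open>M\<close>, and \<open>M\<close> cancels when averaging over the
    hidden graph.\<close>
  define c1 where "c1 = t / 2 * M"
  define c2 where "c2 = 1 / (lam\<^sup>2 * t * M)"
  have M: "0 < M" using card_H_pos by (simp add: M_def)
  have c: "0 \<le> c1" "0 \<le> c2" using M \<open>0 < t\<close> by (auto simp: c1_def c2_def)
  have k_meas [measurable]: "(\<lambda>A. k A G) \<in> borel_measurable N" for G
    unfolding k_def by (rule kernel_measurable[OF K])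
  then have \<kappa>_meas [measurable]: "\<kappa> S \<in> borel_measurable N" for S
    unfolding \<kappa>_def by measurable
  have lik_meas [measurable]: "lik S \<in> borel_measurable N" if "S \<in> H" for S
    using H_sub[OF that] by (rule lik_measurable)
  have I_H: "S' \<in> H" if "S' \<in> I S" for S S' using that by (simp add: I_def)
  define Y where "Y A = (\<Sum>S\<in>H. \<Sum>S'\<in>I S. lik S A * lik S' A)" for A
  have Y_meas [measurable]: "Y \<in> borel_measurable N"
    unfolding Y_def by (intro borel_measurable_sum borel_measurable_times_ennreal lik_meas) (auto dest: I_H)
  have "(\<Sum>S\<in>H. \<integral>\<^sup>+ A. \<kappa> S A \<partial>W S) = (\<Sum>S\<in>H. \<integral>\<^sup>+ A. lik S A * \<kappa> S A \<partial>N)"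
    using H_sub by (intro sum.cong refl nn_integral_W) auto
  also have "\<dots> = (\<integral>\<^sup>+ A. (\<Sum>S\<in>H. lik S A * \<kappa> S A) \<partial>N)"
    by (rule nn_integral_sum[symmetric]) (intro borel_measurable_times_ennreal lik_meas \<kappa>_meas)
  also have "\<dots> \<le> (\<integral>\<^sup>+ A. ennreal c1 + ennreal c2 * Y A \<partial>N)"
  proof (rule nn_integral_mono_AE)
    show "AE A in N. (\<Sum>S\<in>H. lik S A * \<kappa> S A) \<le> ennreal c1 + ennreal c2 * Y A"
      using AE_N_finite AE_space
    proof eventually_elim
      case (elim A)
      define w where "w S = (\<Prod>e\<in>S. \<rho> (A e))" for S
      have w: "lik S A = ennreal (w S)" if "S \<in> H" for S
        unfolding w_def using H_sub[OF that] elim(1) by (rule lik_eq_ennreal)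
      have w_nn: "0 \<le> w S" for S by (simp add: w_def prod_nonneg)
      have Y: "Y A = ennreal (\<Sum>S\<in>H. \<Sum>S'\<in>I S. w S * w S')"
        unfolding Y_def by (auto simp: w w_nn I_H sum_nonneg simp flip: ennreal_mult sum_ennreal intro!: sum.cong)
      have "(\<Sum>S\<in>H. lik S A * \<kappa> S A) = (\<Sum>S\<in>H. \<Sum>G\<in>H. if (S, G) \<in> X then lik S A * k A G else 0)"
        by (auto simp: \<kappa>_def sum_distrib_left sum.inter_filter intro!: sum.cong)
      also have "\<dots> = (\<Sum>G\<in>H. \<Sum>S\<in>H. if (S, G) \<in> X then lik S A * k A G else 0)"
        by (rule sum.swap)
      also have "\<dots> = (\<Sum>G\<in>H. (\<Sum>S | S \<in> H \<and> (S, G) \<in> X. lik S A) * k A G)"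
        by (simp add: sum_distrib_right flip: sum.inter_filter)
      \<comment> \<open>The bound is the same for every guess \<open>G\<close>, so averaging over
        the kernel preserves it.\<close>
      also have "\<dots> \<le> (\<Sum>G\<in>H. (ennreal c1 + ennreal c2 * Y A) * k A G)"
      proof (intro sum_mono mult_right_mono)
        fix G assume G: "G \<in> H"
        have "(\<Sum>S | S \<in> H \<and> (S, G) \<in> X. w S) \<le>
            t * M / 2 + (\<Sum>S\<in>H. \<Sum>S' | S' \<in> H \<and> lam\<^sup>2 * real m / 2 \<le> real (card (S \<inter> S')). w S * w S') / (lam\<^sup>2 * (t * M))"
          using G M \<open>0 < t\<close> \<open>0 < lam\<close> m_pos H_size w_nn finite_graph
          by (intro overlapping_family_sum_le) (auto simp: X_def)
        also have "\<dots> = c1 + c2 * (\<Sum>S\<in>H. \<Sum>S'\<in>I S. w S * w S')"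
          by (simp add: c1_def c2_def I_def ac_simps)
        finally have "ennreal (\<Sum>S | S \<in> H \<and> (S, G) \<in> X. w S) \<le> ennreal (c1 + c2 * (\<Sum>S\<in>H. \<Sum>S'\<in>I S. w S * w S'))"
          by (rule ennreal_leI)
        also have "\<dots> = ennreal c1 + ennreal c2 * Y A"
          using c w_nn by (simp add: Y sum_nonneg ennreal_mult)
        also have "ennreal (\<Sum>S | S \<in> H \<and> (S, G) \<in> X. w S) = (\<Sum>S | S \<in> H \<and> (S, G) \<in> X. lik S A)"
          using w_nn by (simp add: w flip: sum_ennreal)
        finally show "(\<Sum>S | S \<in> H \<and> (S, G) \<in> X. lik S A) \<le> ennreal c1 + ennreal c2 * Y A" .
      qed simp
      also have "\<dots> = ennreal c1 + ennreal c2 * Y A"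
        using kernel_sum[OF K elim(2)] by (simp add: k_def flip: sum_distrib_left)
      finally show ?case .
    qed
  qed
  also have "\<dots> = ennreal c1 + ennreal c2 * (\<integral>\<^sup>+ A. Y A \<partial>N)"
    using prob_space.emeasure_space_1[OF prob_space_N]
    by (simp add: nn_integral_add nn_integral_cmult)
  also have "(\<integral>\<^sup>+ A. Y A \<partial>N) = (\<Sum>S\<in>H. \<integral>\<^sup>+ A. (\<Sum>S'\<in>I S. lik S A * lik S' A) \<partial>N)"
    unfolding Y_def
    by (intro nn_integral_sum borel_measurable_sum borel_measurable_times_ennreal lik_meas) (auto dest: I_H)
  also have "\<dots> = (\<Sum>S\<in>H. \<Sum>S'\<in>I S. \<integral>\<^sup>+ A. lik S A * lik S' A \<partial>N)"
    by (intro sum.cong refl nn_integral_sum borel_measurable_times_ennreal lik_meas) (auto dest: I_H)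
  also have "\<dots> \<le> (\<Sum>S\<in>H. \<Sum>S'\<in>I S. ennreal (B ^ card (S \<inter> S')))"
    using H_sub I_H B by (intro sum_mono second_moment) auto
  also have "\<dots> = ennreal (\<Sum>S\<in>H. \<Sum>S'\<in>I S. B ^ card (S \<inter> S'))"
    using B(2) by (simp add: sum_nonneg flip: sum_ennreal)
  also have "\<dots> \<le> ennreal (\<Sum>S\<in>H. V * M)"
    using V by (intro ennreal_leI sum_mono) (simp add: I_def M_def)
  also have "(\<Sum>S\<in>H. V * M) = V * M\<^sup>2" by (simp add: M_def power2_eq_square)
  finally have "(\<Sum>S\<in>H. \<integral>\<^sup>+ A. \<kappa> S A \<partial>W S) \<le> ennreal c1 + ennreal c2 * ennreal (V * M\<^sup>2)"
    by (simp add: mult_left_mono add_left_mono)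
  also have "\<dots> = ennreal (M * (t / 2 + V / (lam\<^sup>2 * t)))"
    using c \<open>0 \<le> V\<close> M \<open>0 < t\<close> \<open>0 < lam\<close>
    by (simp add: c1_def c2_def power2_eq_square field_simps flip: ennreal_mult ennreal_plus)
  finally have "(\<Sum>S\<in>H. \<integral>\<^sup>+ A. \<kappa> S A \<partial>W S) / of_nat (card H) \<le>
      ennreal (M * (t / 2 + V / (lam\<^sup>2 * t))) / of_nat (card H)"
    by (rule divide_right_mono_ennreal)
  also have "\<dots> = ennreal (t / 2 + V / (lam\<^sup>2 * t))"
    using H_ne \<open>0 \<le> V\<close> \<open>0 < t\<close>
    by (simp add: M_def ennreal_of_nat_eq_real_of_nat divide_ennreal card_gt_0_iff)
  finally show ?thesis
    unfolding emeasure_recovery_law[OF K] by (simp add: \<kappa>_def k_def X_def)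
qed

section \<open>Maximum likelihood estimation\<close>

lemma log_likelihood_ratio_eq:
  assumes "S \<in> H" "\<forall>e\<in>E. r (A e) \<noteq> \<infinity>"
  shows "log_likelihood_ratio P Q A S = eln (lik S A)"
  unfolding log_likelihood_ratio_def using assms H_sub[OF assms(1)] by (intro eln_prod[symmetric]) auto

text \<open>Passing from \<open>log_likelihood_ratio A S \<le> log_likelihood_ratio A G\<close> to the symmetric
  difference cancels the factors of the common edges, which needs them to be neither \<open>0\<close> nor \<open>\<infinity>\<close>.\<close>

lemma lik_diff_le:
  assumes "S \<in> H" "G \<in> H" "\<forall>e\<in>E. r (A e) \<noteq> \<infinity>" "\<forall>e\<in>S \<inter> E. r (A e) \<noteq> 0"
    and le: "lik S A \<le> lik G A"
  shows "lik (S - G) A \<le> lik (G - S) A"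
proof -
  have fin: "finite S" "finite G" using assms finite_graph by auto
  have "lik (S \<inter> G) A * lik (S - G) A \<le> lik (S \<inter> G) A * lik (G - S) A"
    using le prod.Int_Diff[OF fin(1), of "\<lambda>e. r (A e)" G] prod.Int_Diff[OF fin(2), of "\<lambda>e. r (A e)" S]
    by (simp add: Int_commute)
  moreover have "lik (S \<inter> G) A \<noteq> 0"
    using assms(4) H_sub[OF assms(1)] fin by (auto simp: prod_zero_iff)
  moreover have "lik (S \<inter> G) A \<noteq> \<infinity>"
    using assms(3) H_sub[OF assms(1)] by (auto simp: ennreal_prod_eq_top)
  ultimately show ?thesis
    by (metis ennreal_mult_le_mult_iff infinity_ennreal_def)
qed

text \<open>Off two bad events no far \<open>G\<close> is a maximizer: \<open>lik (S - G)\<close>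
  would exceed \<open>exp (k * z)\<close> while \<open>lik (G - S)\<close> stays below it, with
  \<open>k = card (S - G) = card (G - S)\<close>. Here \<open>b1\<close> bounds the lower tail for
  one edge set; its union bound runs over subsets of \<open>S\<close> rather than over the graphs
  \<open>G\<close>, hence the factor \<open>2 ^ m\<close>. The upper tails, summed over the far
  graphs, give \<open>b2\<close>.\<close>

lemma mle_recovery_le:
  assumes K: "K \<in> N \<rightarrow>\<^sub>M prob_algebra (count_space H)"
    and mle: "\<forall>A\<in>space N. AE G in K A. is_arg_max (log_likelihood_ratio P Q A) (\<lambda>S. S \<in> H) G"
    and s: "0 < s" and B: "(\<integral>\<^sup>+ x. ennreal (\<rho> x powr (- s)) \<partial>P) \<le> ennreal B" "0 \<le> B"
    and b1: "\<And>k. k \<le> m \<Longrightarrow> \<delta> * real m < real k \<Longrightarrow> B ^ k / exp (- s * (real k * z)) \<le> b1" "0 \<le> b1"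
    and b2: "\<And>S. S \<in> H \<Longrightarrow> (\<Sum>G | G \<in> H \<and> real (card (S \<inter> G)) < (1 - \<delta>) * real m.
        exp (- (real m - real (card (S \<inter> G))) * z)) \<le> b2" "0 \<le> b2"
  shows "emeasure (recovery_law n H P Q K) {(S, G). real (card (G \<inter> S)) < (1 - \<delta>) * real m}
    \<le> ennreal (2 ^ m * b1 + b2)"
proof -
  define X where "X = {(S, G). real (card (G \<inter> S :: graph)) < (1 - \<delta>) * real m}"
  define k where "k A G = emeasure (K A) {G}" for A G
  define \<kappa> where "\<kappa> S A = (\<Sum>G | G \<in> H \<and> (S, G) \<in> X. k A G)" for S A
  \<comment> \<open>The exponent \<open>- s\<close> is negative, so this is the event that the
    product over \<open>T\<close> is positive and at most \<open>exp (card T * z)\<close>.\<close>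
  define low where "low T = {A\<in>space N. exp (- s * (real (card T) * z)) \<le> (\<Prod>e\<in>T. \<rho> (A e)) powr (- s)}" for T
  define high where "high S G = {A\<in>space N. ennreal (exp (real (card (G - S)) * z)) \<le> lik (G - S) A}" for S G
  have \<kappa>_le_1: "\<kappa> S A \<le> 1" if "A \<in> space N" for S A
    unfolding \<kappa>_def k_def by (rule kernel_le_1[OF K that])
  have low_sets: "low T \<in> sets N" if "T \<subseteq> E" for T
  proof -
    have [measurable]: "e \<in> T \<Longrightarrow> (\<lambda>A. r (A e)) \<in> borel_measurable N" for e
      using that by (intro r_comp_measurable) auto
    show ?thesis unfolding low_def by measurable
  qed
  have high_sets: "high S G \<in> sets N" if "G \<in> H" for S G
  proof -
    have [measurable]: "lik (G - S) \<in> borel_measurable N"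
      using H_sub[OF that] by (intro lik_measurable) auto
    show ?thesis unfolding high_def by measurable
  qed
  have one: "(\<integral>\<^sup>+ A. \<kappa> S A \<partial>W S) \<le> ennreal (2 ^ m * b1 + b2)" if S: "S \<in> H" for S
  proof -
    define TT where "TT = {T. T \<subseteq> S \<and> \<delta> * real m < real (card T)}"
    define GG where "GG = {G. G \<in> H \<and> real (card (S \<inter> G)) < (1 - \<delta>) * real m}"
    define U1 where "U1 = (\<Union>T\<in>TT. low T)"
    define U2 where "U2 = (\<Union>G\<in>GG. high S G)"
    have finTT: "finite TT" using finite_graph[OF S] by (simp add: TT_def)
    have finGG: "finite GG" by (simp add: GG_def)
    have SE: "S \<subseteq> E" by (rule H_sub[OF S])
    have U1_sets: "low T \<in> sets (W S)" if "T \<in> TT" for T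
      using that SE by (auto simp: sets_W TT_def intro!: low_sets)
    have U2_sets: "high S G \<in> sets (W S)" if "G \<in> GG" for G
      using that by (auto simp: sets_W GG_def intro!: high_sets)
    \<comment> \<open>Members of \<open>H\<close> have equal size, so as many edges are missed as
      are wrongly added.\<close>
    have diff: "real (card (S - G)) = real m - real (card (S \<inter> G))"
      "real (card (G - S)) = real m - real (card (S \<inter> G))" if "G \<in> H" for G
    proof -
      have fin: "finite S" "finite G" using S that finite_graph by auto
      have "card S = card (S \<inter> G) + card (S - G)" "card G = card (G \<inter> S) + card (G - S)"
        using fin by (auto simp: card_Int_Diff)
      then show "real (card (S - G)) = real m - real (card (S \<inter> G))"
        "real (card (G - S)) = real m - real (card (S \<inter> G))"
        using H_size[OF S] H_size[OF that] by (simp_all add: Int_commute)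
    qed
    have "(\<integral>\<^sup>+ A. \<kappa> S A \<partial>W S) \<le> (\<integral>\<^sup>+ A. indicator (U1 \<union> U2) A \<partial>W S)"
    proof (rule nn_integral_mono_AE)
      show "AE A in W S. \<kappa> S A \<le> indicator (U1 \<union> U2) A"
        using AE_regular[of S] AE_space
      proof eventually_elim
        case (elim A)
        then have A: "A \<in> space N" "\<forall>e\<in>E. r (A e) \<noteq> \<infinity>" "\<forall>e\<in>S \<inter> E. r (A e) \<noteq> 0" by auto
        show ?case
        proof (cases "A \<in> U1 \<union> U2")
          case True
          then show ?thesis using \<kappa>_le_1[OF A(1)] by simp
        next
          case False
          have "k A G = 0" if G: "G \<in> H" "(S, G) \<in> X" for G
          proof (rule ccontr)
            assume k: "k A G \<noteq> 0"
            \<comment> \<open>An almost sure property holds at every atom of positive mass.\<close>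
            have "is_arg_max (log_likelihood_ratio P Q A) (\<lambda>S. S \<in> H) G"
            proof (rule ccontr)
              assume no: "\<not> is_arg_max (log_likelihood_ratio P Q A) (\<lambda>S. S \<in> H) G"
              have sets_K: "sets (K A) = sets (count_space H)"
                by (rule sets_kernel[OF measurable_prob_algebraD[OF K] A(1)])
              have "AE G' in K A. G' \<noteq> G"
                using mle A(1) no by (force elim: eventually_mono)
              then have "emeasure (K A) {G} = 0"
                using AE_iff_measurable[of "{G}" "K A" "\<lambda>G'. G' \<noteq> G"] sets_K sets_eq_imp_space_eq[OF sets_K] G(1)
                by auto
              with k show False by (simp add: k_def)
            qed
            then have "log_likelihood_ratio P Q A S \<le> log_likelihood_ratio P Q A G"
              using S by (auto simp: is_arg_max_linorder)
            then have "lik S A \<le> lik G A"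
              using S G A by (simp add: log_likelihood_ratio_eq eln_le_eln_iff)
            then have le: "lik (S - G) A \<le> lik (G - S) A"
              using S G A by (intro lik_diff_le) auto
            have card_lt: "real (card (S \<inter> G)) < (1 - \<delta>) * real m"
              using G by (simp add: X_def Int_commute)
            then have "S - G \<in> TT"
              using diff[OF G(1)] by (simp add: TT_def left_diff_distrib)
            then have not_low: "A \<notin> low (S - G)" using False by (auto simp: U1_def)
            have "G \<in> GG" using G card_lt by (simp add: GG_def)
            then have not_high: "A \<notin> high S G" using False by (auto simp: U2_def)
            define p where "p = (\<Prod>e\<in>S - G. \<rho> (A e))"
            define \<tau> where "\<tau> = real (card (S - G)) * z"
            have lik_p: "lik (S - G) A = ennreal p"
              unfolding p_def using SE A by (intro lik_eq_ennreal) auto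
            \<comment> \<open>Positivity matters because \<open>powr\<close> with a negative
              exponent is decreasing only on the positive reals and sends 0 to 0.\<close>
            have "0 < p"
              unfolding p_def using SE A by (intro prod_pos) (auto simp: enn2real_positive_iff less_top[symmetric] zero_less_iff_neq_zero)
            have "p powr (- s) < exp \<tau> powr (- s)"
              using not_low A(1) by (auto simp: low_def p_def \<tau>_def exp_powr_real not_le ac_simps)
            then have "exp \<tau> < p"
              using s \<open>0 < p\<close> powr_mono2'[of "- s" p "exp \<tau>"] by fastforce
            moreover have "lik (G - S) A < ennreal (exp \<tau>)"
              using not_high A(1) diff[OF G(1)] by (auto simp: high_def \<tau>_def not_le)
            ultimately show False
              using le unfolding lik_p by (meson ennreal_leI less_imp_le not_le order.strict_trans1)
          qed
          then have "\<kappa> S A = 0" by (auto simp: \<kappa>_def)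
          then show ?thesis by simp
        qed
      qed
    qed
    also have "\<dots> = emeasure (W S) (U1 \<union> U2)"
      unfolding U1_def U2_def
      by (intro nn_integral_indicator sets.Un sets.finite_UN finTT finGG U1_sets U2_sets)
    also have "\<dots> \<le> emeasure (W S) U1 + emeasure (W S) U2"
      unfolding U1_def U2_def
      by (intro emeasure_subadditive sets.finite_UN finTT finGG U1_sets U2_sets)
    also have "emeasure (W S) U1 \<le> (\<Sum>T\<in>TT. emeasure (W S) (low T))"
      unfolding U1_def using U1_sets by (intro emeasure_subadditive_finite finTT) auto
    also have "\<dots> \<le> (\<Sum>T\<in>TT. ennreal b1)"
    proof (rule sum_mono)
      fix T assume T: "T \<in> TT"
      then have "card T \<le> m" using card_mono[OF finite_graph[OF S], of T] H_size[OF S] by (simp add: TT_def)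
      have "emeasure (W S) (low T) \<le> ennreal (B ^ card T / exp (- s * (real (card T) * z)))"
        unfolding low_def using SE T B by (intro chernoff_W) (auto simp: TT_def)
      also have "\<dots> \<le> ennreal b1"
        using T \<open>card T \<le> m\<close> by (intro ennreal_leI b1) (auto simp: TT_def)
      finally show "emeasure (W S) (low T) \<le> ennreal b1" .
    qed
    also have "\<dots> = ennreal (real (card TT) * b1)"
      using b1(2) by (simp add: ennreal_mult ennreal_of_nat_eq_real_of_nat)
    also have "\<dots> \<le> ennreal (2 ^ m * b1)"
    proof (intro ennreal_leI mult_right_mono b1(2))
      have "card TT \<le> card (Pow S)" using finite_graph[OF S] by (intro card_mono) (auto simp: TT_def)
      also have "\<dots> = 2 ^ m" using finite_graph[OF S] H_size[OF S] by (simp add: card_Pow)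
      finally show "real (card TT) \<le> 2 ^ m" by (metis of_nat_le_iff of_nat_numeral of_nat_power)
    qed
    also have "emeasure (W S) U2 \<le> (\<Sum>G\<in>GG. emeasure (W S) (high S G))"
      unfolding U2_def using U2_sets by (intro emeasure_subadditive_finite finGG) auto
    also have "\<dots> \<le> (\<Sum>G\<in>GG. ennreal (exp (- (real m - real (card (S \<inter> G))) * z)))"
    proof (rule sum_mono)
      fix G assume "G \<in> GG"
      then have G: "G \<in> H" by (simp add: GG_def)
      have "emeasure (W S) (high S G) \<le> ennreal (exp (- (real (card (G - S)) * z)))"
        unfolding high_def using H_sub[OF G] by (intro markov_null) auto
      also have "- (real (card (G - S)) * z) = - (real m - real (card (S \<inter> G))) * z"
        by (simp only: diff[OF G] mult_minus_left)
      finally show "emeasure (W S) (high S G) \<le> ennreal (exp (- (real m - real (card (S \<inter> G))) * z))" .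
    qed
    also have "\<dots> = ennreal (\<Sum>G\<in>GG. exp (- (real m - real (card (S \<inter> G))) * z))"
      by (rule sum_ennreal) simp
    also have "\<dots> \<le> ennreal b2"
      unfolding GG_def by (intro ennreal_leI b2(1) S)
    finally show ?thesis
      using b1(2) b2(2) by (simp add: add_left_mono add_right_mono flip: ennreal_plus)
  qed
  define c where "c = 2 ^ m * b1 + b2"
  have "0 \<le> c" using b1(2) b2(2) by (simp add: c_def)
  have "(\<Sum>S\<in>H. \<integral>\<^sup>+ A. \<kappa> S A \<partial>W S) \<le> of_nat (card H) * ennreal c"
    using sum_mono[OF one] by (simp add: c_def)
  then have "(\<Sum>S\<in>H. \<integral>\<^sup>+ A. \<kappa> S A \<partial>W S) / of_nat (card H) \<le> of_nat (card H) * ennreal c / of_nat (card H)"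
    by (rule divide_right_mono_ennreal)
  also have "\<dots> = ennreal c"
    using \<open>0 \<le> c\<close> H_ne
    by (simp add: ennreal_of_nat_eq_real_of_nat divide_ennreal card_gt_0_iff flip: ennreal_mult)
  finally show ?thesis
    unfolding emeasure_recovery_law[OF K] by (simp add: \<kappa>_def k_def X_def c_def)
qed

end

section \<open>Asymptotics\<close>

text \<open>Taking \<open>\<delta> n\<close> to be the least \<open>1 / (j + 1)\<close>, \<open>j \<le> n\<close>, with \<open>p n (1 / (j + 1)) \<le> 1 / (j + 1)\<close>
  needs no monotonicity of \<open>p n\<close>.\<close>

lemma diagonal_sequence:
  fixes p :: "nat \<Rightarrow> real \<Rightarrow> real"
  assumes nn: "\<And>n x. 0 \<le> p n x" and lim: "\<And>x. 0 < x \<Longrightarrow> (\<lambda>n. p n x) \<longlonglongrightarrow> 0"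
  shows "\<exists>\<delta>. \<delta> \<longlonglongrightarrow> 0 \<and> (\<lambda>n. p n (\<delta> n)) \<longlonglongrightarrow> 0"
proof -
  define A where "A n = {j. j \<le> n \<and> p n (inverse (real (Suc j))) \<le> inverse (real (Suc j))}" for n
  \<comment> \<open>The inserted \<open>0\<close> keeps the maximum defined when \<open>A n\<close>
    is empty; eventually \<open>0 \<in> A n\<close>, and then \<open>J n \<in> A n\<close>.\<close>
  define J where "J n = Max (insert 0 (A n))" for n
  define \<delta> where "\<delta> n = inverse (real (Suc (J n)))" for n
  have fin: "finite (A n)" for n by (simp add: A_def)
  have inA: "\<forall>\<^sub>F n in sequentially. j \<in> A n" for j
  proof -
    have "\<forall>\<^sub>F n in sequentially. p n (inverse (real (Suc j))) < inverse (real (Suc j))"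
      using lim by (rule order_tendstoD) auto
    then show ?thesis using eventually_ge_at_top[of j] by eventually_elim (simp add: A_def)
  qed
  have "filterlim J at_top sequentially"
    unfolding filterlim_at_top
  proof
    fix j
    show "\<forall>\<^sub>F n in sequentially. j \<le> J n"
      using inA[of j] by eventually_elim (simp add: J_def fin)
  qed
  then have \<delta>: "\<delta> \<longlonglongrightarrow> 0"
    unfolding \<delta>_def by (rule filterlim_compose[OF LIMSEQ_inverse_real_of_nat])
  have "\<forall>\<^sub>F n in sequentially. p n (\<delta> n) \<le> \<delta> n"
    using inA[of 0]
  proof eventually_elim
    case (elim n)
    have "J n \<in> insert 0 (A n)" unfolding J_def using fin by (intro Max_in) auto
    with elim have "J n \<in> A n" by auto
    then show ?case by (simp add: A_def \<delta>_def)
  qed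
  then have "(\<lambda>n. p n (\<delta> n)) \<longlonglongrightarrow> 0"
    using nn by (intro tendsto_sandwich[OF _ _ tendsto_const \<delta>]) auto
  with \<delta> show ?thesis by blast
qed

section \<open>Uniform sparsity in counting form\<close>

context hidden_weighted_graph
begin

abbreviation L :: "nat \<Rightarrow> real" where "L n \<equiv> ln (1 / p1M (H n) (m n))"
abbreviation rec_law where "rec_law K n \<equiv> recovery_law n (H n) (P n) (Q n) (K n)"

lemma planted: "1 \<le> n \<Longrightarrow> 0 < m n \<Longrightarrow> planted_graph (P n) (Q n) n (m n) (H n)"
  unfolding planted_graph_def planted_graph_axioms_def
  using prob_space_P prob_space_Q sets_P P_ac_Q H_nonempty H_subgraph H_card by blast

lemma eventually_planted:
  "\<forall>\<^sub>F n in sequentially. planted_graph (P n) (Q n) n (m n) (H n)"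
  using eventually_ge_at_top[of 1] filterlim_at_top[THEN iffD1, OF m_at_top, rule_format, of 1]
  by eventually_elim (rule planted, auto)

lemma mL_eq:
  assumes "planted_graph (P n) (Q n) n (m n) (H n)"
  shows "real (m n) * L n = ln (real (card (H n)))" "0 \<le> L n" "exp (real (m n) * L n) = real (card (H n))"
proof -
  interpret planted_graph "P n" "Q n" n "m n" "H n" by fact
  have M: "0 < real (card (H n))" using card_H_pos by simp
  have L: "L n = ln (real (card (H n))) / real (m n)"
    using M by (simp add: p1M_def ln_div ln_powr)
  then show eq: "real (m n) * L n = ln (real (card (H n)))"
    using m_pos by simp
  show "0 \<le> L n" unfolding L using card_H_pos by simp
  show "exp (real (m n) * L n) = real (card (H n))" unfolding eq using M by simp
qed

text \<open>The Landau symbol only controls the absolute value; \<open>0 \<le> L n\<close> gives the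
  sign.\<close>

lemma L_at_top:
  assumes "uniformly_sparse H m"
  shows "filterlim L at_top sequentially"
  unfolding filterlim_at_top
proof
  fix c :: real
  have "L \<in> \<omega>(\<lambda>_. 1)" using assms by (simp add: uniformly_sparse_def)
  then have "\<forall>\<^sub>F n in sequentially. norm (L n) \<ge> (\<bar>c\<bar> + 1) * norm (1 :: real)"
    by (rule landau_omega.smallD) simp
  then show "\<forall>\<^sub>F n in sequentially. c \<le> L n"
    using eventually_planted by eventually_elim (use mL_eq(2) in fastforce)
qed

text \<open>Exponentiating the sparsity condition turns it into a bound on counts. The
  \<open>o(log M)\<close> error becomes \<open>c * m * L\<close> for an arbitrary constant
  \<open>c > 0\<close>, as \<open>log M = m * L\<close>.\<close>

lemma eventually_sparse:
  assumes "uniformly_sparse H m" "0 < c"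
  shows "\<forall>\<^sub>F n in sequentially. \<forall>S\<in>H n. \<forall>l\<le>m n.
    real (card {S'\<in>H n. card (S \<inter> S') = l}) \<le> exp ((c * real (m n) - real l) * L n) * real (card (H n))"
proof -
  define f where "f n H1 l = eln (ennreal (measure_pmf.prob (pmf_of_set (H n)) {H2. card (H1 \<inter> H2) = l})) +
    ereal (real l * L n)" for n and H1 :: graph and l
  define V where "V n = (MAX H1\<in>H n. MAX l\<in>{0..m n}. f n H1 l)" for n
  have "(\<lambda>n. real_of_ereal (V n)) \<in> o(\<lambda>n. ln (real (card (H n))))"
    using assms(1) by (simp add: uniformly_sparse_def V_def f_def)
  then have "\<forall>\<^sub>F n in sequentially. norm (real_of_ereal (V n)) \<le> c * norm (ln (real (card (H n))))"
    using assms(2) by (rule landau_o.smallD)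
  then show ?thesis
    using eventually_planted
  proof eventually_elim
    case (elim n)
    interpret planted_graph "P n" "Q n" n "m n" "H n" by fact
    note mL = mL_eq[OF elim(2)]
    have le_V: "f n S l \<le> V n" if "S \<in> H n" "l \<le> m n" for S l
    proof -
      have "f n S l \<le> (MAX l\<in>{0..m n}. f n S l)" using that by (intro Max_ge) auto
      also have "\<dots> \<le> V n" unfolding V_def using that by (intro Max_ge) auto
      finally show ?thesis .
    qed
    \<comment> \<open>Only the value \<open>\<infinity>\<close> of \<open>V n\<close> has to be
      excluded: \<open>real_of_ereal\<close> maps \<open>- \<infinity>\<close> to 0, which is still
      an upper bound.\<close>
    have f_fin: "f n S l \<noteq> \<infinity>" for S l
      by (simp add: f_def eln_def)
    have "V n \<in> (\<lambda>S. MAX l\<in>{0..m n}. f n S l) ` H n"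
      unfolding V_def using H_ne by (intro Max_in) auto
    then obtain S0 where S0: "V n = (MAX l\<in>{0..m n}. f n S0 l)" by blast
    have "(MAX l\<in>{0..m n}. f n S0 l) \<in> f n S0 ` {0..m n}"
      by (rule Max_in) auto
    then obtain l0 where "(MAX l\<in>{0..m n}. f n S0 l) = f n S0 l0" by blast
    then have "V n \<noteq> \<infinity>" using f_fin[of S0 l0] by (simp add: S0)
    then have "V n \<le> ereal (real_of_ereal (V n))" by (cases "V n") auto
    also have "\<dots> \<le> ereal (c * real (m n) * L n)"
    proof -
      have "\<bar>ln (real (card (H n)))\<bar> = real (m n) * L n"
        using mL(1) card_H_pos by simp
      then have "\<bar>real_of_ereal (V n)\<bar> \<le> c * (real (m n) * L n)"
        using elim(1) by (simp only: real_norm_def)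
      then show ?thesis using abs_ge_self[of "real_of_ereal (V n)"] by (simp add: mult.assoc)
    qed
    finally have V: "V n \<le> ereal (c * real (m n) * L n)" .
    show ?case
    proof (intro ballI allI impI)
      fix S l assume S: "S \<in> H n" "l \<le> m n"
      define q where "q = real (card {S'\<in>H n. card (S \<inter> S') = l}) / real (card (H n))"
      have q: "measure_pmf.prob (pmf_of_set (H n)) {H2. card (S \<inter> H2) = l} = q"
        using H_ne by (simp add: measure_pmf_of_set q_def Int_def)
      have "eln (ennreal q) + ereal (real l * L n) \<le> ereal (c * real (m n) * L n)"
        using le_V[OF S] V by (simp add: f_def q)
      then have "eln (ennreal q) \<le> ereal ((c * real (m n) - real l) * L n)"
        by (cases "eln (ennreal q)") (auto simp: algebra_simps)
      then have "q \<le> exp ((c * real (m n) - real l) * L n)"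
        by (simp add: eln_le_iff)
      then show "real (card {S'\<in>H n. card (S \<inter> S') = l}) \<le> exp ((c * real (m n) - real l) * L n) * real (card (H n))"
        using card_H_pos by (simp add: q_def pos_divide_le_eq)
    qed
  qed
qed

lemma exp_neg_m: "0 < c \<Longrightarrow> (\<lambda>n. exp (- c * real (m n))) \<longlonglongrightarrow> 0"
  by (intro filterlim_compose[OF exp_at_bot] filterlim_tendsto_neg_mult_at_bot[OF tendsto_const]
      filterlim_compose[OF filterlim_real_sequentially m_at_top]) auto

text \<open>Once \<open>L n \<ge> 2 / c\<close>, the exponential is at most
  \<open>exp (- 2 * m)\<close>, and half of this exponent pays for
  \<open>m + 1 \<le> exp m\<close>.\<close>

lemma eventually_exp_mL:
  assumes "uniformly_sparse H m" "0 < c"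
  shows "\<forall>\<^sub>F n in sequentially. (real (m n) + 1) * exp (- c * real (m n) * L n) \<le> exp (- real (m n))"
proof -
  have "\<forall>\<^sub>F n in sequentially. 2 / c \<le> L n"
    using L_at_top[OF assms(1)] by (simp add: filterlim_at_top)
  then show ?thesis
  proof eventually_elim
    case (elim n)
    then have "2 \<le> c * L n" using assms(2) by (simp add: field_simps)
    then have "real (m n) * 2 \<le> real (m n) * (c * L n)" by (rule mult_left_mono) simp
    then have "exp (- c * real (m n) * L n) \<le> exp (- (2 * real (m n)))"
      by (simp add: ac_simps)
    moreover have "real (m n) + 1 \<le> exp (real (m n))"
      using exp_ge_add_one_self[of "real (m n)"] by linarith
    ultimately have "(real (m n) + 1) * exp (- c * real (m n) * L n) \<le> exp (real (m n)) * exp (- (2 * real (m n)))"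
      by (intro mult_mono) auto
    also have "\<dots> = exp (- real (m n))" by (simp flip: exp_add)
    finally show ?case .
  qed
qed

section \<open>Achievability\<close>

text \<open>For each fixed \<open>\<delta>\<close> the probability of missing more than
  \<open>\<delta> * m\<close> edges tends to 0; \<open>diagonal_sequence\<close> then lets
  \<open>\<delta>\<close> tend to 0 along with it.\<close>

lemma mle_almost_exact:
  assumes sparse: "uniformly_sparse H m" and stable: "renyi_stable_upper P Q"
    and "0 < \<eta>" and kl: "\<forall>\<^sub>F n in sequentially. kl_div (P n) (Q n) \<ge> ereal ((1 + \<eta>) * L n)"
    and mle: "maximum_likelihood_estimator H P Q K"
  shows "almost_exact_recovery H m P Q K"
proof -
  define p where "p n \<delta> = measure (rec_law K n) {(S, G). real (card (G \<inter> S)) < (1 - \<delta>) * real (m n)}" for n \<delta>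
  have "(\<lambda>n. p n \<delta>) \<longlonglongrightarrow> 0" if \<delta>: "0 < \<delta>" for \<delta>
  proof -
    \<comment> \<open>With this choice the threshold \<open>z = (1 - 2 * \<theta>) * d\<close> is
      still at least \<open>(1 + \<eta> / 2) * L\<close>, and it lies \<open>\<theta> * d\<close>
      below the bound \<open>(1 - \<theta>) * d\<close> on the Renyi divergence.\<close>
    define \<theta> where "\<theta> = \<eta> / (4 * (1 + \<eta>))"
    have \<theta>: "0 < \<theta>" "\<theta> < 1" "(1 - 2 * \<theta>) * (1 + \<eta>) = 1 + \<eta> / 2" "0 < 1 - 2 * \<theta>"
      using \<open>0 < \<eta>\<close> by (auto simp: \<theta>_def field_simps)
    obtain \<alpha> where \<alpha>: "\<And>n. 0 < \<alpha> n" "\<And>n. \<alpha> n < 1"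
      "(\<lambda>n. ereal (1 - \<alpha> n) * kl_div (P n) (Q n)) \<longlonglongrightarrow> \<infinity>"
      "\<forall>\<^sub>F n in sequentially. renyi_div (\<alpha> n) (P n) (Q n) \<ge> ereal (1 - \<theta>) * kl_div (P n) (Q n)"
      using stable[unfolded renyi_stable_upper_def, rule_format, OF \<theta>(1)] by blast
    \<comment> \<open>The gap \<open>\<theta> * d\<close> gives the lower tail of
      \<open>k > \<delta> * m\<close> edges the exponent \<open>- k * \<theta> * s * d\<close>,
      which this makes at most \<open>- 2 * m\<close>, enough to beat \<open>2 ^ m\<close>
      subsets.\<close>
    have "\<forall>\<^sub>F n in sequentially. ereal (2 / (\<theta> * \<delta>)) < ereal (1 - \<alpha> n) * kl_div (P n) (Q n)"
      using \<alpha>(3) by (simp add: tendsto_PInfty)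
    \<comment> \<open>A graph missing at least \<open>\<delta> * m\<close> edges gains
      \<open>\<delta> * \<eta> / 2 * m * L\<close> in the exponent from
      \<open>z \<ge> (1 + \<eta> / 2) * L\<close>; half of it is spent on the sparsity
      error.\<close>
    moreover have "0 < \<delta> * \<eta> / 4" using \<delta> \<open>0 < \<eta>\<close> by simp
    note eventually_sparse[OF sparse this] eventually_exp_mL[OF sparse this]
    ultimately have bound: "\<forall>\<^sub>F n in sequentially. p n \<delta> \<le> 2 * exp (- 1 * real (m n))"
      using \<alpha>(4) kl eventually_planted eventually_ge_at_top[of 1]
    proof eventually_elim
      case (elim n)
      interpret planted_graph "P n" "Q n" n "m n" "H n" by fact
      note mL = mL_eq[OF elim(6)]
      have Kn: "K n \<in> Pi\<^sub>M (complete_edges n) (\<lambda>_. Q n) \<rightarrow>\<^sub>M prob_algebra (count_space (H n))"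
        using mle elim(7) by (simp add: maximum_likelihood_estimator_def estimator_def)
      define s where "s = 1 - \<alpha> n"
      have s: "0 < s" using \<alpha>(2)[of n] by (simp add: s_def)
      \<comment> \<open>A finite stand-in for the divergence: it need only be a lower bound, so if
        the divergence is infinite any large enough real will do.\<close>
      obtain d where d: "(1 + \<eta>) * L n \<le> d" "2 / (\<theta> * \<delta>) \<le> s * d" "ereal d \<le> kl_div (P n) (Q n)"
      proof (cases rule: kl_div_cases[of "P n" "Q n"])
        case (1 d)
        then show ?thesis using that[of d] elim(1,5) by (simp add: s_def)
      next
        case 2
        have "2 / (\<theta> * \<delta>) = s * (2 / (\<theta> * \<delta>) / s)" using s by simp
        also have "\<dots> \<le> s * max ((1 + \<eta>) * L n) (2 / (\<theta> * \<delta>) / s)" 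
          using s by (intro mult_left_mono) auto
        finally show ?thesis using 2 by (intro that) auto
      qed
      define z where "z = (1 - 2 * \<theta>) * d"
      define B where "B = exp (- s * ((1 - \<theta>) * d))"
      have "ereal (1 - \<theta>) * ereal d \<le> ereal (1 - \<theta>) * kl_div (P n) (Q n)"
        using d(3) \<theta> by (intro ereal_mult_left_mono) auto
      then have "ereal ((1 - \<theta>) * d) \<le> ereal (1 - \<theta>) * kl_div (P n) (Q n)"
        by simp
      then have "ereal ((1 - \<theta>) * d) \<le> renyi_div (\<alpha> n) (P n) (Q n)"
        using elim(4) by (rule order.trans)
      from renyi_div_ge_imp[OF \<alpha>(2) this]
      have B: "(\<integral>\<^sup>+ x. ennreal (enn2real (RN_deriv (Q n) (P n) x) powr (- s)) \<partial>P n) \<le> ennreal B"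
        by (simp add: s_def B_def)
      have z_ge: "(1 + \<eta> / 2) * L n \<le> z"
        using mult_left_mono[OF d(1), of "1 - 2 * \<theta>"] \<theta>(3,4) unfolding z_def mult.assoc[symmetric] by simp
      have "emeasure (rec_law K n) {(S, G). real (card (G \<inter> S)) < (1 - \<delta>) * real (m n)} \<le>
          ennreal (2 ^ m n * exp (- (2 * real (m n))) + exp (- real (m n)))"
      proof (rule mle_recovery_le[OF Kn _ s B, where z = z])
        show "\<forall>A\<in>space (Pi\<^sub>M (complete_edges n) (\<lambda>_. Q n)).
            AE G in K n A. is_arg_max (log_likelihood_ratio (P n) (Q n) A) (\<lambda>S. S \<in> H n) G"
          using mle elim(7) by (simp add: maximum_likelihood_estimator_def)
      next
        fix k assume k: "k \<le> m n" "\<delta> * real (m n) < real k"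
        have "B ^ k / exp (- s * (real k * z)) = exp (real k * (- s * ((1 - \<theta>) * d)) - (- s * (real k * z)))"
          by (simp only: B_def exp_of_nat_mult exp_diff)
        also have "real k * (- s * ((1 - \<theta>) * d)) - (- s * (real k * z)) = - (real k * (\<theta> * (s * d)))"
          by (simp add: z_def algebra_simps)
        also have "exp (- (real k * (\<theta> * (s * d)))) \<le> exp (- (2 * real (m n)))"
        proof -
          have "2 \<le> \<theta> * \<delta> * (s * d)" using d(2) \<theta> \<delta> by (simp add: field_simps)
          then have "real (m n) * 2 \<le> real (m n) * (\<theta> * \<delta> * (s * d))" by (rule mult_left_mono) simp
          also have "\<dots> = (\<delta> * real (m n)) * (\<theta> * (s * d))" by simp
          also have "\<dots> \<le> real k * (\<theta> * (s * d))"
          proof (rule mult_right_mono)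
            have "0 \<le> s * d" using \<theta> \<delta> by (intro order.trans[OF _ d(2)]) auto
            then show "0 \<le> \<theta> * (s * d)" using \<theta> by simp
          qed (use k in simp)
          finally show ?thesis by simp
        qed
        finally show "B ^ k / exp (- s * (real k * z)) \<le> exp (- (2 * real (m n)))" .
      next
        fix S assume S: "S \<in> H n"
        have "(\<Sum>G | G \<in> H n \<and> real (card (S \<inter> G)) < (1 - \<delta>) * real (m n).
            exp (- (real (m n) - real (card (S \<inter> G))) * z)) \<le>
            (real (m n) + 1) * exp (- (\<delta> * \<eta> / 4) * real (m n) * L n)"
        proof (rule sum_overlap_le[where p = "\<lambda>l. real l < (1 - \<delta>) * real (m n)" 
              and f = "\<lambda>l. exp (- (real (m n) - real l) * z)"
              and g = "\<lambda>l. exp ((\<delta> * \<eta> / 4 * real (m n) - real l) * L n) * real (card (H n))"])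
          show "card (S \<inter> S') \<le> m n" if "S' \<in> H n" for S'
            using card_mono[OF finite_graph[OF S], of "S \<inter> S'"] H_size[OF S] by simp
          show "real (card {S' \<in> H n. card (S \<inter> S') = l})
              \<le> exp ((\<delta> * \<eta> / 4 * real (m n) - real l) * L n) * real (card (H n))" if "l \<le> m n" for l
            using elim(2) S that by blast
          fix l assume l: "l \<le> m n" "real l < (1 - \<delta>) * real (m n)"
          have "(real (m n) - real l) * ((1 + \<eta> / 2) * L n) \<le> (real (m n) - real l) * z"
            using z_ge l by (intro mult_left_mono) auto
          moreover have "(\<delta> * real (m n)) * (\<eta> / 2 * L n) \<le> (real (m n) - real l) * (\<eta> / 2 * L n)"
            using l mL(2) \<open>0 < \<eta>\<close> by (intro mult_right_mono) (auto simp: algebra_simps)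
          ultimately have "(\<delta> * \<eta> / 4 * real (m n) - real l) * L n + real (m n) * L n + - (real (m n) - real l) * z
              \<le> - (\<delta> * \<eta> / 4) * real (m n) * L n"
          proof -
            assume le: "(real (m n) - real l) * ((1 + \<eta> / 2) * L n) \<le> (real (m n) - real l) * z"
              "(\<delta> * real (m n)) * (\<eta> / 2 * L n) \<le> (real (m n) - real l) * (\<eta> / 2 * L n)"
            have "(real (m n) - real l) * ((1 + \<eta> / 2) * L n) =
                (real (m n) - real l) * L n + (real (m n) - real l) * (\<eta> / 2 * L n)"
              by (simp only: distrib_left distrib_right mult_1_left)
            moreover have "(\<delta> * \<eta> / 4 * real (m n) - real l) * L n + real (m n) * L n + - (real (m n) - real l) * z =
                - (\<delta> * \<eta> / 4) * real (m n) * L n + (\<delta> * real (m n)) * (\<eta> / 2 * L n) +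
                ((real (m n) - real l) * L n - (real (m n) - real l) * z)"
              by (simp add: field_simps)
            ultimately show ?thesis using le by linarith
          qed
          moreover have "exp ((\<delta> * \<eta> / 4 * real (m n) - real l) * L n) * real (card (H n)) * exp (- (real (m n) - real l) * z) =
              exp ((\<delta> * \<eta> / 4 * real (m n) - real l) * L n + real (m n) * L n + - (real (m n) - real l) * z)"
            by (simp only: exp_add mL(3))
          ultimately show "exp ((\<delta> * \<eta> / 4 * real (m n) - real l) * L n) * real (card (H n)) * exp (- (real (m n) - real l) * z)
              \<le> exp (- (\<delta> * \<eta> / 4) * real (m n) * L n)"
            by simp
        qed auto
        also have "\<dots> \<le> exp (- real (m n))" by (rule elim(3))
        finally show "(\<Sum>G | G \<in> H n \<and> real (card (S \<inter> G)) < (1 - \<delta>) * real (m n).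
            exp (- (real (m n) - real (card (S \<inter> G))) * z)) \<le> exp (- real (m n))" .
      qed (auto simp: B_def)
      also have "\<dots> \<le> ennreal (2 * exp (- 1 * real (m n)))"
      proof (intro ennreal_leI)
        \<comment> \<open>The \<open>2 ^ m\<close> subsets use up one factor \<open>exp m\<close> of
          the tail bound \<open>exp (- 2 * m)\<close>.\<close>
        have "(2 :: real) \<le> exp 1" using exp_ge_add_one_self[of 1] by simp
        then have "2 ^ m n * exp (- (2 * real (m n))) \<le> exp 1 ^ m n * exp (- (2 * real (m n)))"
          by (intro mult_right_mono power_mono) auto
        also have "\<dots> = exp (real (m n) * 1 + - (2 * real (m n)))" by (simp only: exp_of_nat_mult exp_add)
        finally show "2 ^ m n * exp (- (2 * real (m n))) + exp (- real (m n)) \<le> 2 * exp (- 1 * real (m n))"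
          by simp
      qed
      finally show ?case
        unfolding p_def by (intro recovery_prob_le[OF Kn]) auto
    qed
    have "(\<lambda>n. 2 * exp (- 1 * real (m n))) \<longlonglongrightarrow> 0"
      using tendsto_mult_right_zero[OF exp_neg_m[of 1], of 2] by simp
    then show ?thesis
      by (rule tendsto_sandwich[OF _ bound tendsto_const, rotated]) (auto simp: p_def)
  qed
  then have "\<exists>\<delta>. \<delta> \<longlonglongrightarrow> 0 \<and> (\<lambda>n. p n (\<delta> n)) \<longlonglongrightarrow> 0"
    by (intro diagonal_sequence) (auto simp: p_def)
  then show ?thesis
    by (simp add: almost_exact_recovery_def p_def)
qed

section \<open>Impossibility below the threshold\<close>

text \<open>The divergence hypothesis is imposed separately at each \<open>n\<close>, and
  \<open>b\<close> is common to all estimators. The converse can therefore invoke the bound at a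
  single \<open>n\<close> where the divergence happens to be small.\<close>

lemma fails_uniformly:
  assumes sparse: "uniformly_sparse H m" and stable: "renyi_stable_lower P Q"
    and \<eta>: "0 < \<eta>" "\<eta> < lam"
  shows "\<exists>b. b \<longlonglongrightarrow> 0 \<and> (\<forall>\<^sub>F n in sequentially.
    kl_div (P n) (Q n) \<le> ereal ((lam - \<eta>) * L n) \<longrightarrow>
    (\<forall>K. estimator H Q K \<longrightarrow>
      measure (rec_law K n) {(S, G). real (card (G \<inter> S)) \<ge> lam * real (m n)} \<le> b n))"
proof -
  \<comment> \<open>The loss factor \<open>1 + \<theta>\<close> uses at most
    \<open>\<eta> / 4\<close> of the gap \<open>\<eta>\<close> between the divergence bound and
    \<open>lam\<close>.\<close>
  define \<theta> where "\<theta> = \<eta> / (4 * lam)"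
  have \<theta>: "0 < \<theta>" "(1 + \<theta>) * (lam - \<eta>) \<le> lam - 3 * \<eta> / 4"
    using \<eta> by (auto simp: \<theta>_def field_simps)
  obtain \<beta> c0 where \<beta>: "\<And>n. 1 < \<beta> n" "0 < c0"
    "\<forall>\<^sub>F n in sequentially. ereal (\<beta> n - 1) * kl_div (P n) (Q n) \<ge> ereal c0"
    "\<forall>\<^sub>F n in sequentially. renyi_div (\<beta> n) (P n) (Q n) \<le> ereal (1 + \<theta>) * kl_div (P n) (Q n)"
    using stable[unfolded renyi_stable_lower_def, rule_format, OF \<theta>(1)] by blast
  \<comment> \<open>The Chernoff exponent per edge is \<open>- (\<eta> / 4) * s * L\<close>. From
    \<open>s * d \<ge> c0\<close> and \<open>d \<le> lam * L\<close> follows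
    \<open>s * L \<ge> c0 / lam\<close>, so it is at most \<open>- c\<close>.\<close>
  define c where "c = \<eta> * c0 / (4 * lam)"
  have c: "0 < c" using \<eta> \<beta>(2) by (simp add: c_def)
  define b where "b n = exp (- c * real (m n)) + exp (- 1 * real (m n))" for n
  have "b \<longlonglongrightarrow> 0"
    unfolding b_def using tendsto_add[OF exp_neg_m[OF c] exp_neg_m[of 1]] by simp
  have "0 < \<eta> / 4" using \<eta> by simp
  note eventually_sparse[OF sparse this] eventually_exp_mL[OF sparse this]
  then have "\<forall>\<^sub>F n in sequentially.
    kl_div (P n) (Q n) \<le> ereal ((lam - \<eta>) * L n) \<longrightarrow>
    (\<forall>K. estimator H Q K \<longrightarrow>
      measure (rec_law K n) {(S, G). real (card (G \<inter> S)) \<ge> lam * real (m n)} \<le> b n)"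
    using \<beta>(3,4) eventually_planted eventually_ge_at_top[of 1]
  proof eventually_elim
    case (elim n)
    interpret planted_graph "P n" "Q n" n "m n" "H n" by fact
    note mL = mL_eq[OF elim(5)]
    show ?case
    proof (intro impI allI)
      fix K
      assume kl: "kl_div (P n) (Q n) \<le> ereal ((lam - \<eta>) * L n)" and "estimator H Q K"
      then have K: "K n \<in> Pi\<^sub>M (complete_edges n) (\<lambda>_. Q n) \<rightarrow>\<^sub>M prob_algebra (count_space (H n))"
        using elim by (simp add: estimator_def)
      define s where "s = \<beta> n - 1"
      have s: "0 < s" using \<beta>(1)[of n] by (simp add: s_def)
      obtain d where d: "kl_div (P n) (Q n) = ereal d"
        using kl by (cases rule: kl_div_cases[of "P n" "Q n"]) auto
      have d_le: "d \<le> (lam - \<eta>) * L n" and sd: "c0 \<le> s * d"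
        using kl elim(3) by (simp_all add: d s_def)
      define B where "B = exp (s * ((1 + \<theta>) * d))"
      \<comment> \<open>The cut lies \<open>\<eta> / 4\<close> above the Chernoff mean
        \<open>lam - 3 * \<eta> / 4\<close> and \<open>\<eta> / 2\<close> below the null exponent
        \<open>lam\<close>, in units of \<open>m * L\<close>; of the latter gap the sparsity error
        takes \<open>\<eta> / 4\<close>.\<close>
      define \<tau> where "\<tau> = (lam - \<eta> / 2) * (real (m n) * L n)"
      define \<nu> where "\<nu> = (real (m n) + 1) * exp ((\<eta> / 4 - lam) * real (m n) * L n)"
      have "renyi_div (\<beta> n) (P n) (Q n) \<le> ereal ((1 + \<theta>) * d)"
        using elim(4) by (simp add: d)
      from renyi_div_le_imp[OF \<beta>(1) this]
      have B: "(\<integral>\<^sup>+ x. ennreal (enn2real (RN_deriv (Q n) (P n) x) powr s) \<partial>P n) \<le> ennreal B"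
        by (simp add: s_def B_def)
      have "emeasure (rec_law K n) {(S, G). real (card (G \<inter> S)) \<ge> lam * real (m n)} \<le>
          ennreal (B ^ m n / exp (s * \<tau>) + exp \<tau> * \<nu>)"
      proof (rule recovery_le_change_of_measure[OF K s B])
        fix G assume G: "G \<in> H n"
        have "real (card {S \<in> H n. (S, G) \<in> {(S, G). lam * real (m n) \<le> real (card (G \<inter> S))}}) =
            (\<Sum>S | S \<in> H n \<and> lam * real (m n) \<le> real (card (G \<inter> S)). 1)" by simp
        also have "\<dots> \<le> (real (m n) + 1) * (exp ((\<eta> / 4 - lam) * real (m n) * L n) * real (card (H n)))"
        proof (rule sum_overlap_le[where p = "\<lambda>l. lam * real (m n) \<le> real l" and f = "\<lambda>_. 1"
              and g = "\<lambda>l. exp ((\<eta> / 4 * real (m n) - real l) * L n) * real (card (H n))"])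
          show "card (G \<inter> S') \<le> m n" if "S' \<in> H n" for S'
            using card_mono[OF finite_graph[OF G], of "G \<inter> S'"] H_size[OF G] by simp
          show "real (card {S' \<in> H n. card (G \<inter> S') = l})
              \<le> exp ((\<eta> / 4 * real (m n) - real l) * L n) * real (card (H n))" if "l \<le> m n" for l
            using elim G that by blast
          fix l assume "lam * real (m n) \<le> real l"
          then have "(\<eta> / 4 * real (m n) - real l) * L n \<le> ((\<eta> / 4 - lam) * real (m n)) * L n"
            using mL(2) by (intro mult_right_mono) (auto simp: algebra_simps)
          then show "exp ((\<eta> / 4 * real (m n) - real l) * L n) * real (card (H n)) * 1
              \<le> exp ((\<eta> / 4 - lam) * real (m n) * L n) * real (card (H n))"
            by (simp add: mult_right_mono)
        qed auto
        finally show "real (card {S \<in> H n. (S, G) \<in> {(S, G). lam * real (m n) \<le> real (card (G \<inter> S))}})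
            \<le> \<nu> * real (card (H n))"
          by (simp add: \<nu>_def mult.assoc)
      qed (auto simp: B_def \<nu>_def)
      also have "\<dots> \<le> ennreal (b n)"
        unfolding b_def
      proof (intro ennreal_leI add_mono)
        have "(1 + \<theta>) * d \<le> (1 + \<theta>) * ((lam - \<eta>) * L n)"
          using d_le \<theta> by (intro mult_left_mono) auto
        also have "\<dots> \<le> (lam - 3 * \<eta> / 4) * L n"
          using mult_right_mono[OF \<theta>(2) mL(2)] by (simp add: mult.assoc)
        finally have "(1 + \<theta>) * d - (lam - \<eta> / 2) * L n \<le> - (\<eta> / 4) * L n"
          by (simp add: algebra_simps)
        then have "s * ((1 + \<theta>) * d - (lam - \<eta> / 2) * L n) \<le> s * (- (\<eta> / 4) * L n)"
          using s by (intro mult_left_mono) auto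
        also have "\<dots> = - (\<eta> / 4) * (s * L n)" by simp
        also have "\<dots> \<le> - (\<eta> / 4) * (c0 / lam)"
        proof -
          have "d \<le> lam * L n"
            using \<eta> by (intro order.trans[OF d_le] mult_right_mono mL(2)) auto
          then have "c0 \<le> s * (lam * L n)"
            using sd mult_left_mono[of d "lam * L n" s] s by linarith
          then have "c0 / lam \<le> s * L n" using \<eta> by (simp add: field_simps)
          then show ?thesis using \<eta> by (intro mult_left_mono_neg) auto
        qed
        also have "\<dots> = - c" by (simp add: c_def)
        finally have "real (m n) * (s * ((1 + \<theta>) * d - (lam - \<eta> / 2) * L n)) \<le> real (m n) * - c"
          by (rule mult_left_mono) simp
        moreover have "B ^ m n / exp (s * \<tau>) = exp (real (m n) * (s * ((1 + \<theta>) * d - (lam - \<eta> / 2) * L n)))"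
        proof -
          have "B ^ m n / exp (s * \<tau>) = exp (real (m n) * (s * ((1 + \<theta>) * d)) - s * \<tau>)"
            by (simp only: B_def exp_of_nat_mult exp_diff)
          also have "real (m n) * (s * ((1 + \<theta>) * d)) - s * \<tau> =
              real (m n) * (s * ((1 + \<theta>) * d - (lam - \<eta> / 2) * L n))"
            by (simp only: \<tau>_def right_diff_distrib) (simp only: ac_simps)
          finally show ?thesis .
        qed
        ultimately show "B ^ m n / exp (s * \<tau>) \<le> exp (- c * real (m n))"
          by (simp add: mult.commute)
        have "exp \<tau> * \<nu> = (real (m n) + 1) * exp (\<tau> + (\<eta> / 4 - lam) * real (m n) * L n)"
          by (simp add: \<nu>_def exp_add)
        also have "\<tau> + (\<eta> / 4 - lam) * real (m n) * L n = - (\<eta> / 4) * real (m n) * L n"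
          by (simp add: \<tau>_def algebra_simps)
        also have "(real (m n) + 1) * exp (- (\<eta> / 4) * real (m n) * L n) \<le> exp (- 1 * real (m n))"
          using elim(2) by simp
        finally show "exp \<tau> * \<nu> \<le> exp (- 1 * real (m n))" .
      qed
      finally show "measure (rec_law K n) {(S, G). real (card (G \<inter> S)) \<ge> lam * real (m n)} \<le> b n"
        by (intro recovery_prob_le[OF K]) (auto simp: b_def)
    qed
  qed
  with \<open>b \<longlonglongrightarrow> 0\<close> show ?thesis by blast
qed

lemma fails_below_threshold:
  assumes "uniformly_sparse H m" "renyi_stable_lower P Q" "0 < \<eta>" "\<eta> < lam"
    and kl: "\<forall>\<^sub>F n in sequentially. kl_div (P n) (Q n) \<le> ereal ((lam - \<eta>) * L n)"
    and K: "estimator H Q K"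
  shows "fails_to_recover_fraction H m P Q K lam"
proof -
  obtain b where b: "b \<longlonglongrightarrow> 0" "\<forall>\<^sub>F n in sequentially.
    kl_div (P n) (Q n) \<le> ereal ((lam - \<eta>) * L n) \<longrightarrow>
    (\<forall>K. estimator H Q K \<longrightarrow>
      measure (rec_law K n) {(S, G). real (card (G \<inter> S)) \<ge> lam * real (m n)} \<le> b n)"
    using fails_uniformly[OF assms(1-4)] by blast
  from b(2) kl have "\<forall>\<^sub>F n in sequentially.
      measure (rec_law K n) {(S, G). real (card (G \<inter> S)) \<ge> lam * real (m n)} \<le> b n"
    by eventually_elim (use K in blast)
  then show ?thesis
    unfolding fails_to_recover_fraction_def
    by (rule tendsto_sandwich[OF _ _ tendsto_const b(1), rotated]) auto
qed

text \<open>If the divergence were below \<open>(1 - e) * L\<close> at a large \<open>n\<close>,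
  then with \<open>lam = 1 - e / 2\<close> the events of overlap below
  \<open>(1 - \<delta>) * m\<close> and of overlap at least \<open>lam * m\<close> would both have
  probability below 1/2. They cover everything once \<open>\<delta> < e / 2\<close>.\<close>

lemma almost_exact_imp_kl_ge:
  assumes sparse: "uniformly_sparse H m" and stable: "renyi_stable_lower P Q"
    and K: "estimator H Q K" and rec: "almost_exact_recovery H m P Q K"
  shows "\<exists>\<epsilon>. \<epsilon> \<longlonglongrightarrow> 0 \<and> (\<forall>\<^sub>F n in sequentially. kl_div (P n) (Q n) \<ge> ereal ((1 - \<epsilon> n) * L n))"
proof -
  obtain \<delta> where \<delta>: "\<delta> \<longlonglongrightarrow> 0"
    "(\<lambda>n. measure (rec_law K n) {(S, G). real (card (G \<inter> S)) < (1 - \<delta> n) * real (m n)}) \<longlonglongrightarrow> 0"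
    using rec by (auto simp: almost_exact_recovery_def)
  have ge: "\<forall>\<^sub>F n in sequentially. ereal ((1 - e) * L n) \<le> kl_div (P n) (Q n)" if e: "0 < e" "e < 1" for e
  proof -
    define lam where "lam = 1 - e / 2"
    have lam: "0 < e / 2" "e / 2 < lam" "lam - e / 2 = 1 - e" using e by (auto simp: lam_def)
    obtain b where b: "b \<longlonglongrightarrow> 0" "\<forall>\<^sub>F n in sequentially.
      kl_div (P n) (Q n) \<le> ereal ((lam - e / 2) * L n) \<longrightarrow>
      (\<forall>K. estimator H Q K \<longrightarrow>
        measure (rec_law K n) {(S, G). real (card (G \<inter> S)) \<ge> lam * real (m n)} \<le> b n)"
      using fails_uniformly[OF sparse stable lam(1,2)] by blast
    have "\<forall>\<^sub>F n in sequentially. b n < 1 / 2" using b(1) by (rule order_tendstoD) simp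
    moreover have "\<forall>\<^sub>F n in sequentially. \<delta> n < e / 2" using \<delta>(1) by (rule order_tendstoD) (use e in simp)
    moreover have "\<forall>\<^sub>F n in sequentially.
        measure (rec_law K n) {(S, G). real (card (G \<inter> S)) < (1 - \<delta> n) * real (m n)} < 1 / 2"
      using \<delta>(2) by (rule order_tendstoD) simp
    ultimately show ?thesis
      using b(2) eventually_planted eventually_ge_at_top[of 1]
    proof eventually_elim
      case (elim n)
      interpret planted_graph "P n" "Q n" n "m n" "H n" by fact
      have Kn: "K n \<in> Pi\<^sub>M (complete_edges n) (\<lambda>_. Q n) \<rightarrow>\<^sub>M prob_algebra (count_space (H n))"
        using K elim by (simp add: estimator_def)
      interpret R: prob_space "rec_law K n" by (rule prob_space_recovery_law[OF Kn])
      let ?A = "{(S, G). real (card (G \<inter> S)) < (1 - \<delta> n) * real (m n)} :: (graph \<times> graph) set"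
      let ?B = "{(S, G). real (card (G \<inter> S)) \<ge> lam * real (m n)} :: (graph \<times> graph) set"
      show ?case
      proof (rule ccontr)
        assume "\<not> ?case"
        then have "measure (rec_law K n) ?B \<le> b n"
          using elim(4) K lam(3) by simp
        moreover have "?A \<union> ?B = UNIV"
        proof -
          have "lam * real (m n) \<le> (1 - \<delta> n) * real (m n)"
            using elim(2) by (intro mult_right_mono) (auto simp: lam_def)
          then show ?thesis by auto
        qed
        moreover have "measure (rec_law K n) UNIV = 1"
          using R.prob_space sets_eq_imp_space_eq[of "rec_law K n" "count_space UNIV"]
          by (simp add: sets_recovery_law[OF Kn])
        moreover have "measure (rec_law K n) (?A \<union> ?B) \<le> measure (rec_law K n) ?A + measure (rec_law K n) ?B"
          by (intro measure_Un_le) (auto simp: sets_recovery_law[OF Kn])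
        ultimately show False using elim by simp
      qed
    qed
  qed
  \<comment> \<open>The relative deficit of the divergence, cut off at 0. As
    \<open>real_of_ereal\<close> maps \<open>\<infinity>\<close> to 0, the infinite case is set
    apart.\<close>
  define \<epsilon> where "\<epsilon> n = (if kl_div (P n) (Q n) = \<infinity> then 0 else max 0 (1 - real_of_ereal (kl_div (P n) (Q n)) / L n))" for n
  have L_pos: "\<forall>\<^sub>F n in sequentially. 0 < L n"
    using L_at_top[OF sparse] by (simp add: filterlim_at_top_dense)
  have "\<epsilon> \<longlonglongrightarrow> 0"
  proof (rule order_tendstoI)
    fix a :: real assume "a < 0"
    then show "\<forall>\<^sub>F n in sequentially. a < \<epsilon> n"
      by (intro always_eventually) (auto simp: \<epsilon>_def)
  next
    fix a :: real assume a: "0 < a"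
    define e where "e = min (a / 2) (1 / 2)"
    have e: "0 < e" "e < 1" "e < a" using a by (auto simp: e_def)
    show "\<forall>\<^sub>F n in sequentially. \<epsilon> n < a"
      using ge[OF e(1,2)] L_pos
    proof eventually_elim
      case (elim n)
      show ?case
      proof (cases rule: kl_div_cases[of "P n" "Q n"])
        case (1 d)
        then have "1 - e \<le> d / L n" using elim by (simp add: pos_le_divide_eq)
        then show ?thesis using e a 1 by (simp add: \<epsilon>_def)
      next
        case 2
        then show ?thesis using a by (simp add: \<epsilon>_def)
      qed
    qed
  qed
  moreover have "\<forall>\<^sub>F n in sequentially. kl_div (P n) (Q n) \<ge> ereal ((1 - \<epsilon> n) * L n)"
    using L_pos
  proof eventually_elim
    case (elim n)
    show ?case
    proof (cases rule: kl_div_cases[of "P n" "Q n"])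
      case (1 d)
      then have "1 - \<epsilon> n \<le> d / L n" by (simp add: \<epsilon>_def)
      then have "(1 - \<epsilon> n) * L n \<le> d" using elim by (simp add: pos_le_divide_eq)
      with 1 show ?thesis by simp
    qed simp
  qed
  ultimately show ?thesis by blast
qed

section \<open>All or nothing\<close>

text \<open>Graphs overlapping a given one in \<open>l\<close> edges have frequency about
  \<open>exp (- l * L)\<close>, while the pair moment is at most
  \<open>exp (l * (1 - \<eta>) * L)\<close>. The product decays like
  \<open>exp (- \<eta> * l * L)\<close>, and only \<open>l \<ge> lam\<^sup>2 * m / 2\<close>
  enters.\<close>

lemma all_or_nothing:
  assumes sparse: "uniformly_sparse H m" and \<eta>: "0 < \<eta>"
    and renyi: "\<forall>\<^sub>F n in sequentially. renyi_div 2 (P n) (Q n) \<le> ereal ((1 - \<eta>) * L n)"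
    and K: "estimator H Q K" and lam: "0 < lam"
  shows "fails_to_recover_fraction H m P Q K lam"
proof -
  \<comment> \<open>This is half of the decay rate \<open>\<eta> * lam\<^sup>2 / 2\<close> at the
    smallest relevant overlap; the other half absorbs the sparsity error.\<close>
  define c where "c = \<eta> * lam\<^sup>2 / 4"
  have c: "0 < c" using \<eta> lam by (simp add: c_def)
  define C where "C = 1 / 2 + 1 / lam\<^sup>2"
  have bound: "\<forall>\<^sub>F n in sequentially.
      measure (rec_law K n) {(S, G). real (card (G \<inter> S)) \<ge> lam * real (m n)} \<le> exp (- (1 / 2) * real (m n)) * C"
    using renyi eventually_sparse[OF sparse c] eventually_exp_mL[OF sparse c] eventually_planted eventually_ge_at_top[of 1]
  proof eventually_elim
    case (elim n)
    interpret planted_graph "P n" "Q n" n "m n" "H n" by fact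
    note mL = mL_eq[OF elim(4)]
    have Kn: "K n \<in> Pi\<^sub>M (complete_edges n) (\<lambda>_. Q n) \<rightarrow>\<^sub>M prob_algebra (count_space (H n))"
      using K elim by (simp add: estimator_def)
    define B where "B = exp ((1 - \<eta>) * L n)"
    \<comment> \<open>This balances the two terms \<open>t / 2\<close> and
      \<open>V / (lam\<^sup>2 * t)\<close>, since \<open>V = exp (- m) = t\<^sup>2\<close>.\<close>
    define t where "t = exp (- (1 / 2) * real (m n))"
    have "(\<integral>\<^sup>+ x. ennreal (enn2real (RN_deriv (Q n) (P n) x) powr (2 - 1)) \<partial>P n) \<le> ennreal (exp ((2 - 1) * ((1 - \<eta>) * L n)))"
      using elim(1) by (intro renyi_div_le_imp) auto
    then have B: "(\<integral>\<^sup>+ x. ennreal (enn2real (RN_deriv (Q n) (P n) x)) \<partial>P n) \<le> ennreal B"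
      by (simp add: B_def)
    have "emeasure (rec_law K n) {(S, G). lam * real (m n) \<le> real (card (G \<inter> S))} \<le>
        ennreal (t / 2 + exp (- real (m n)) / (lam\<^sup>2 * t))"
    proof (rule recovery_le_second_moment[OF Kn B _ lam])
      fix S assume S: "S \<in> H n"
      have "(\<Sum>S' | S' \<in> H n \<and> lam\<^sup>2 * real (m n) / 2 \<le> real (card (S \<inter> S')). B ^ card (S \<inter> S')) \<le>
          (real (m n) + 1) * (exp (- c * real (m n) * L n) * real (card (H n)))"
      proof (rule sum_overlap_le[where p = "\<lambda>l. lam\<^sup>2 * real (m n) / 2 \<le> real l" and f = "\<lambda>l. B ^ l"
            and g = "\<lambda>l. exp ((c * real (m n) - real l) * L n) * real (card (H n))"])
        show "card (S \<inter> S') \<le> m n" if "S' \<in> H n" for S'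
          using card_mono[OF finite_graph[OF S], of "S \<inter> S'"] H_size[OF S] by simp
        show "real (card {S' \<in> H n. card (S \<inter> S') = l})
            \<le> exp ((c * real (m n) - real l) * L n) * real (card (H n))" if "l \<le> m n" for l
          using elim S that by blast
        fix l assume l: "lam\<^sup>2 * real (m n) / 2 \<le> real l"
        have "(lam\<^sup>2 * real (m n) / 2) * (\<eta> * L n) \<le> real l * (\<eta> * L n)"
          using l mL(2) \<eta> by (intro mult_right_mono) auto
        then have "(c * real (m n) - real l) * L n + real l * ((1 - \<eta>) * L n) \<le> - c * real (m n) * L n"
          by (simp add: c_def algebra_simps)
        moreover have "exp ((c * real (m n) - real l) * L n) * real (card (H n)) * B ^ l =
            exp ((c * real (m n) - real l) * L n + real l * ((1 - \<eta>) * L n)) * real (card (H n))"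
          by (simp only: B_def exp_add exp_of_nat_mult ac_simps)
        ultimately show "exp ((c * real (m n) - real l) * L n) * real (card (H n)) * B ^ l
            \<le> exp (- c * real (m n) * L n) * real (card (H n))"
          by (metis exp_le_cancel_iff mult_right_mono of_nat_0_le_iff)
      qed (auto simp: B_def)
      also have "\<dots> \<le> exp (- real (m n)) * real (card (H n))"
        using mult_right_mono[OF elim(3), of "real (card (H n))"] by (simp add: mult.assoc)
      finally show "(\<Sum>S' | S' \<in> H n \<and> lam\<^sup>2 * real (m n) / 2 \<le> real (card (S \<inter> S')). B ^ card (S \<inter> S'))
          \<le> exp (- real (m n)) * real (card (H n))" .
    qed (auto simp: B_def t_def)
    also have "exp (- real (m n)) / (lam\<^sup>2 * t) = t / lam\<^sup>2"
    proof -
      have "exp (- real (m n)) = t * t" by (simp add: t_def flip: exp_add)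
      then show ?thesis by (simp add: t_def)
    qed
    also have "t / 2 + t / lam\<^sup>2 = t * C" by (simp add: C_def distrib_left)
    finally show ?case
      unfolding t_def by (intro recovery_prob_le[OF Kn]) (auto simp: C_def)
  qed
  have "(\<lambda>n. exp (- (1 / 2) * real (m n)) * C) \<longlonglongrightarrow> 0"
    by (intro tendsto_mult_left_zero exp_neg_m) simp
  then show ?thesis
    unfolding fails_to_recover_fraction_def
    by (rule tendsto_sandwich[OF _ bound tendsto_const, rotated]) auto
qed

end

theorem theorem3:
  fixes H :: "nat \<Rightarrow> graph set" and m :: "nat \<Rightarrow> nat" and P Q :: "nat \<Rightarrow> 'w measure"
  assumes "hidden_weighted_graph H m P Q"
    and "uniformly_sparse H m"
    and "renyi_stable P Q"
  shows
    "(\<forall>\<eta>::real. \<eta> > 0 \<longrightarrow>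
        (\<forall>\<^sub>F n in sequentially.
           kl_div (P n) (Q n) \<ge> ereal ((1 + \<eta>) * ln (1 / p1M (H n) (m n)))) \<longrightarrow>
        (\<forall>K. maximum_likelihood_estimator H P Q K \<longrightarrow> almost_exact_recovery H m P Q K))
   \<and> ((\<exists>K. estimator H Q K \<and> almost_exact_recovery H m P Q K) \<longrightarrow>
        (\<exists>\<epsilon> :: nat \<Rightarrow> real. \<epsilon> \<longlonglongrightarrow> 0 \<and>
           (\<forall>\<^sub>F n in sequentially.
              kl_div (P n) (Q n) \<ge> ereal ((1 - \<epsilon> n) * ln (1 / p1M (H n) (m n))))))
   \<and> (\<forall>(lam::real) (\<eta>::real). 0 < \<eta> \<and> \<eta> < lam \<and> lam < 1 \<longrightarrow>
        (\<forall>\<^sub>F n in sequentially.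
           kl_div (P n) (Q n) \<le> ereal ((lam - \<eta>) * ln (1 / p1M (H n) (m n)))) \<longrightarrow>
        (\<forall>K. estimator H Q K \<longrightarrow> fails_to_recover_fraction H m P Q K lam))
   \<and> (\<forall>\<eta>::real. \<eta> > 0 \<longrightarrow>
        (\<forall>\<^sub>F n in sequentially.
           renyi_div 2 (P n) (Q n) \<le> ereal ((1 - \<eta>) * ln (1 / p1M (H n) (m n)))) \<longrightarrow>
        (\<forall>K. estimator H Q K \<longrightarrow>
           (\<forall>lam::real. 0 < lam \<and> lam < 1 \<longrightarrow> fails_to_recover_fraction H m P Q K lam)))"
proof -
  interpret hidden_weighted_graph H m P Q by fact
  have stable: "renyi_stable_upper P Q" "renyi_stable_lower P Q"
    using assms(3) by (auto simp: renyi_stable_def)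
  show ?thesis
    using mle_almost_exact[OF assms(2) stable(1)] almost_exact_imp_kl_ge[OF assms(2) stable(2)]
      fails_below_threshold[OF assms(2) stable(2)] all_or_nothing[OF assms(2)]
    by blast
qed

end
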